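(* Let $\alpha\ge1/2$ and $0\le p^*<1$, and suppose that $K_\Sigma$ is large enough (i.e. there is $K_0$ such that the following holds for every $K_\Sigma\ge K_0$). Below, $\inf_{\widetilde f_n}$ denotes the infimum over all estimators $\widetilde f_n$ of $f$ based on the sample $X_1,\dots,X_n$. (i) If there are constants $d_1,\beta>0$ such that $$|\phi_Z(t)|\le\frac{d_1}{1+|t|^\beta},\qquad|\phi_Z'(t)|\le\frac{d_1}{1+|t|^\beta}\qquad\text{for all }t\in\mathbb R,$$ then $$\inf_{\widetilde f_n}\ \sup_{f\in\Sigma(\alpha,K_\Sigma),\,p\in[0,p^*]}\mathbb E_{p,f}\left[\int_{-\infty}^\infty(\widetilde f_n(x)-f(x))^2\,dx\right]\gtrsim n^{-2\alpha/(2\alpha+2\beta+1)}.$$ (ii) If there are constants $d_1,\beta,\gamma>0$ such that $$|\phi_Z(t)|\le d_1e^{-|t|^\beta/\gamma},\qquad|\phi_Z'(t)|\le d_1e^{-|t|^\beta/\gamma}\qquad\text{for all }t\in\mathbb R,$$ then, for $n\ge2$, $$\inf_{\widetilde f_n}\ \sup_{f\in\Sigma(\alpha,K_\Sigma),\,p\in[0,p^*]}\mathbb E_{p,f}\left[\int_{-\infty}^\infty(\widetilde f_n(x)-f(x))^2\,dx\right]\gtrsim(\log n)^{-2\alpha/\beta}.$$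
   Context: Model: $X_1,\dots,X_n$ are i.i.d. copies of $X=Y+Z$, where $Y$ and $Z$ are independent, $Y=AV$ with $A$ and $V$ independent, $A$ Bernoulli with $P(A=1)=1-p$, $V$ has probability density $f$ on $\mathbb R$, and $Z$ has a known distribution with density $k$ and characteristic function $\phi_Z$. $\mathbb E_{p,f}$ denotes expectation under the parameter $(p,f)$. $\phi_f(t)=\int_{-\infty}^\infty e^{itx}f(x)\,dx$. Class of densities: $\Sigma(\alpha,K_\Sigma)=\{f \text{ probability density}:\int_{-\infty}^\infty|\phi_f(t)|^2(1+|t|^{2\alpha})\,dt\le K_\Sigma\}$. $a_n\gtrsim b_n$ means $a_n\ge c\,b_n$ for all $n$ (for which the quantities are defined), with a constant $c>0$ not depending on $n$. *)

theory Defs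
  imports "HOL-Probability.Probability"
begin

definition prob_density :: "(real \<Rightarrow> real) \<Rightarrow> bool" where
  "prob_density f \<longleftrightarrow>
     f \<in> borel_measurable borel \<and> (\<forall>x. 0 \<le> f x) \<and> prob_space (density lborel f)"

definition char_fun :: "(real \<Rightarrow> real) \<Rightarrow> real \<Rightarrow> complex" where
  "char_fun f t = (CLINT x|lborel. iexp (t * x) * complex_of_real (f x))"

lemma char_fun_eq_char:
  assumes "prob_density f"
  shows "char_fun f t = char (density lborel f) t"
proof -
  have "char (density lborel f) t = (CLINT x|lborel. f x *\<^sub>R iexp (t * x))"
    unfolding char_def using assms
    by (intro integral_density) (auto simp: prob_density_def)
  then show ?thesis
    by (simp add: char_fun_def scaleR_conv_of_real mult.commute)
qed

definition density_class :: "real \<Rightarrow> real \<Rightarrow> (real \<Rightarrow> real) set" where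
  "density_class \<alpha> K = {f. prob_density f \<and>
     (\<integral>\<^sup>+t. ennreal ((norm (char_fun f t))\<^sup>2 * (1 + \<bar>t\<bar> powr (2 * \<alpha>))) \<partial>lborel) \<le> ennreal K}"

text \<open>The law of \<open>X = A V + Z\<close> for independent \<open>A\<close>, \<open>V\<close>, \<open>Z\<close>, where \<open>P(A = 1) = 1 - p\<close> and
  \<open>V\<close>, \<open>Z\<close> have densities \<open>f\<close>, \<open>k\<close>. The value \<open>1\<close> of \<open>A\<close> is encoded as \<open>True\<close>.\<close>

definition obs_law :: "(real \<Rightarrow> real) \<Rightarrow> real \<Rightarrow> (real \<Rightarrow> real) \<Rightarrow> real measure" where
  "obs_law k p f =
     distr (measure_pmf (bernoulli_pmf (1 - p)) \<Otimes>\<^sub>M density lborel f \<Otimes>\<^sub>M density lborel k) borel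
       (\<lambda>(a, v, z). of_bool a * v + z)"

definition sample_law :: "(real \<Rightarrow> real) \<Rightarrow> nat \<Rightarrow> real \<Rightarrow> (real \<Rightarrow> real) \<Rightarrow> (nat \<Rightarrow> real) measure" where
  "sample_law k n p f = (\<Pi>\<^sub>M i\<in>{1..n}. obs_law k p f)"

text \<open>An estimator maps the sample to a function on the reals; joint measurability makes
  the integrated squared error a random variable with values in \<open>[0, \<infinity>]\<close>.\<close>

definition estimators :: "nat \<Rightarrow> ((nat \<Rightarrow> real) \<Rightarrow> real \<Rightarrow> real) set" where
  "estimators n = {g. case_prod g \<in> borel_measurable ((\<Pi>\<^sub>M i\<in>{1..n}. borel) \<Otimes>\<^sub>M borel)}"

definition risk ::
  "(real \<Rightarrow> real) \<Rightarrow> nat \<Rightarrow> ((nat \<Rightarrow> real) \<Rightarrow> real \<Rightarrow> real) \<Rightarrow> real \<Rightarrow> (real \<Rightarrow> real) \<Rightarrow> ennreal" where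
  "risk k n g p f =
     (\<integral>\<^sup>+xs. (\<integral>\<^sup>+x. ennreal ((g xs x - f x)\<^sup>2) \<partial>lborel) \<partial>sample_law k n p f)"

definition minimax_risk :: "(real \<Rightarrow> real) \<Rightarrow> real \<Rightarrow> real \<Rightarrow> real \<Rightarrow> nat \<Rightarrow> ennreal" where
  "minimax_risk k \<alpha> K pstar n =
     (INF g\<in>estimators n. SUP (f, p)\<in>density_class \<alpha> K \<times> {0..pstar}. risk k n g p f)"

end

theory Submission
  imports Defs
begin

text \<open>Since \<open>p = 0\<close> is admissible, it suffices to treat plain deconvolution, by Assouad's method. Let
  \<open>F\<close> be the Fejer kernel, whose characteristic function is the tent \<open>(1 - |t|)\<^sub>+\<close>, and perturb the
  heavy-tailed density \<open>f\<^sub>0(x) = (F(x) + F(x - 1)) / 2\<close> by \<open>a F(x) cos(2jx)\<close> for the \<open>j\<close> in a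
  subset of a frequency set \<open>J\<close>. The perturbations have disjoint spectra near \<open>\<plusminus>2j\<close>, so they are
  orthogonal and their Sobolev norms add up, while positivity only needs \<open>a |J| \<le> 1/4\<close>. As the
  density of an observation is at least of order \<open>1 / (1 + x\<^sup>2)\<close>, the chi-square distance caused by
  one perturbation \<open>h\<close> is at most of order \<open>\<integral> (1 + x\<^sup>2) (h * k)\<^sup>2\<close>, which by Plancherel is controlled
  by the noise characteristic function and its derivative near the frequency \<open>2j\<close>. For polynomial
  decay take \<open>m \<approx> n\<^bsup>1/(2\<alpha>+2\<beta>+1)\<^esup>\<close>, \<open>J = {m+1..2m}\<close> and \<open>a \<approx> m\<^bsup>-\<alpha>-1/2\<^esup>\<close> (here \<open>\<alpha> \<ge> 1/2\<close> gives
  positivity); for exponential decay take \<open>m \<approx> (\<gamma> log n)\<^bsup>1/\<beta>\<^esup>\<close>, \<open>J = {m+1}\<close> and \<open>a \<approx> m\<^bsup>-\<alpha>\<^esup>\<close>.\<close>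

section \<open>Fourier transforms on the real line\<close>

text \<open>Two constraints compete. Smoothness needs a^2 |J| m^(2\<alpha>) bounded, and
  indistinguishability needs n a^2 \<epsilon>^2 bounded, where \<epsilon> bounds the noise transform
  beyond frequency m; the risk obtained is of order a^2 |J|. With |J| = m the balance is n =
  m^(2\<alpha>+2\<beta>+1), whereas a single frequency would lose the summand 1 and give only
  n^(-2\<alpha>/(2\<alpha>+2\<beta>)). Under exponential decay a power of m is only a power of log
  n, so one frequency suffices.

  The Fejer kernel combines three properties: its transform has compact support, so only noise near
  +-2j matters; that transform is Lipschitz, so one derivative on the Fourier side stays bounded;
  and its tail is no heavier than 1 / x^2, in step with the weight 1 + x^2. It vanishes at the
  nonzero multiples of 2 pi, hence the second, shifted copy in the base density.

  The one inequality \<open>plancherel_le\<close> serves twice: applied to sums of bumps it bounds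
  their L2 distance from below, and applied to a tent times the noise transform it bounds the
  chi-square distance from above.\<close>

definition fourier :: "(real \<Rightarrow> complex) \<Rightarrow> real \<Rightarrow> complex" where
  "fourier u t = (CLINT x|lborel. iexp (t * x) * u x)"

lemma char_fun_eq_fourier: "char_fun f = fourier (\<lambda>x. complex_of_real (f x))"
  by (simp add: char_fun_def fourier_def fun_eq_iff)

lemma integrable_iexp_mult:
  assumes "integrable lborel u"
  shows "integrable lborel (\<lambda>x. iexp (t * x) * u x)"
  by (rule Bochner_Integration.integrable_bound[OF assms])
     (use borel_measurable_integrable[OF assms] in \<open>auto simp: norm_mult\<close>)

lemma norm_fourier_le: "norm (fourier u t) \<le> (LINT x|lborel. norm (u x))"
  unfolding fourier_def by (rule order_trans[OF integral_norm_bound]) (simp add: norm_mult)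

lemma borel_measurable_fourier [measurable]:
  assumes [measurable]: "u \<in> borel_measurable borel"
  shows "fourier u \<in> borel_measurable borel"
  unfolding fourier_def[abs_def] by measurable

lemma borel_measurable_integrable_lborel:
  "integrable lborel u \<Longrightarrow> u \<in> borel_measurable borel"
  using borel_measurable_integrable by fastforce

lemma fourier_add:
  assumes "integrable lborel u" "integrable lborel v"
  shows "fourier (\<lambda>x. u x + v x) t = fourier u t + fourier v t"
  unfolding fourier_def distrib_left
  using assms by (intro Bochner_Integration.integral_add integrable_iexp_mult)

lemma fourier_cmult: "fourier (\<lambda>x. c * u x) t = c * fourier u t"
proof -
  have "(\<lambda>x. iexp (t * x) * (c * u x)) = (\<lambda>x. c * (iexp (t * x) * u x))"
    by (simp add: fun_eq_iff ac_simps)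
  then show ?thesis unfolding fourier_def by simp
qed

lemma fourier_sum:
  assumes "\<And>j. j \<in> J \<Longrightarrow> integrable lborel (u j)"
  shows "fourier (\<lambda>x. \<Sum>j\<in>J. u j x) t = (\<Sum>j\<in>J. fourier (u j) t)"
  unfolding fourier_def sum_distrib_left
  using assms by (intro Bochner_Integration.integral_sum integrable_iexp_mult)

lemma iexp_add: "iexp (a + b) = iexp a * iexp b"
  by (simp add: distrib_left exp_add)

lemma fourier_modulate: "fourier (\<lambda>x. iexp (s * x) * u x) t = fourier u (t + s)"
  unfolding fourier_def
  by (intro Bochner_Integration.integral_cong refl)
     (simp only: distrib_right iexp_add mult.assoc)

lemma fourier_shift: "fourier (\<lambda>x. u (x - s)) t = iexp (t * s) * fourier u t"
proof -
  have "fourier (\<lambda>x. u (x - s)) t = (CLINT x|lborel. iexp (t * (s + 1 * x)) * u x)"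
    unfolding fourier_def by (subst lborel_integral_real_affine[where c=1 and t=s]) auto
  also have "\<dots> = (CLINT x|lborel. iexp (t * s) * (iexp (t * x) * u x))"
    by (intro Bochner_Integration.integral_cong refl) (simp only: mult_1 distrib_left[of t] iexp_add mult.assoc)
  finally show ?thesis by (simp add: fourier_def)
qed

text \<open>Fubini for the kernel \<open>iexp (t * x)\<close>, which is symmetric in its arguments
  and has modulus 1. Plancherel, the inversion for the tent and the formula for a blurred bump all
  move a transform from one factor to the other this way.\<close>

lemma fourier_multiplication:
  assumes u: "integrable lborel u" and v: "integrable lborel v"
  shows "(CLINT t|lborel. fourier u t * v t) = (CLINT x|lborel. u x * fourier v x)"
proof -
  have [measurable]: "u \<in> borel_measurable borel" "v \<in> borel_measurable borel"
    using u v by (auto dest: borel_measurable_integrable_lborel)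
  have "integrable (lborel \<Otimes>\<^sub>M lborel) (\<lambda>(x, t). u x * v t)"
  proof (rule lborel_pair.Fubini_integrable)
    show "(\<lambda>(x, t). u x * v t) \<in> borel_measurable (lborel \<Otimes>\<^sub>M lborel)" by measurable
    show "AE x in lborel. integrable lborel (\<lambda>y. case (x, y) of (x, t) \<Rightarrow> u x * v t)"
      using v by simp
    show "integrable lborel (\<lambda>x. LINT y|lborel. norm (case (x, y) of (x, t) \<Rightarrow> u x * v t))"
      using u by (simp add: norm_mult)
  qed
  then have int: "integrable (lborel \<Otimes>\<^sub>M lborel) (\<lambda>(x, t). iexp (t * x) * u x * v t)"
    by (rule Bochner_Integration.integrable_bound) (auto simp: norm_mult)
  have "(CLINT t|lborel. fourier u t * v t)
      = (CLINT t|lborel. CLINT x|lborel. iexp (t * x) * u x * v t)"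
    unfolding fourier_def by simp
  also have "\<dots> = (CLINT x|lborel. CLINT t|lborel. iexp (t * x) * u x * v t)"
    by (rule lborel_pair.Fubini_integral[OF int])
  also have "\<dots> = (CLINT x|lborel. u x * fourier v x)"
  proof (intro Bochner_Integration.integral_cong refl)
    fix x
    have "(CLINT t|lborel. iexp (t * x) * u x * v t) = (CLINT t|lborel. u x * (iexp (x * t) * v t))"
      by (intro Bochner_Integration.integral_cong refl) (simp add: ac_simps)
    then show "(CLINT t|lborel. iexp (t * x) * u x * v t) = u x * fourier v x"
      by (simp add: fourier_def)
  qed
  finally show ?thesis .
qed

section \<open>Gaussians as regularising weights\<close>

lemma gaussian_eq_std_normal: "exp (- y\<^sup>2 / 2) = sqrt (2 * pi) * std_normal_density y"
  by (simp add: std_normal_density_def)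

lemma integrable_gaussian:
  assumes "e > 0"
  shows "integrable lborel (\<lambda>x::real. exp (- (e * x)\<^sup>2 / 2))"
proof -
  have "integrable lborel (\<lambda>y::real. exp (- y\<^sup>2 / 2))"
    unfolding gaussian_eq_std_normal by (intro integrable_mult_right integrable_normal_density) simp
  then show ?thesis
    using lborel_integrable_real_affine[of "\<lambda>y::real. exp (- y\<^sup>2 / 2)" e 0] assms by simp
qed

lemma integral_gaussian:
  assumes "e > 0"
  shows "(LINT x|lborel. exp (- (e * x)\<^sup>2 / 2)) = sqrt (2 * pi) / e"
proof -
  have "(LINT y|lborel. exp (- y\<^sup>2 / 2)) = sqrt (2 * pi)"
    unfolding gaussian_eq_std_normal by simp
  then show ?thesis
    using lborel_integral_real_affine[of e "\<lambda>y::real. exp (- y\<^sup>2 / 2)" 0] assms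
    by (simp add: field_simps)
qed

lemma fourier_gaussian:
  assumes "e > 0"
  shows "fourier (\<lambda>x. complex_of_real (exp (- (e * x)\<^sup>2 / 2))) t
    = complex_of_real (sqrt (2 * pi) / e * exp (- (t / e)\<^sup>2 / 2))"
proof -
  have 1: "(CLINT y|lborel. iexp (s * y) * complex_of_real (exp (- y\<^sup>2 / 2)))
      = complex_of_real (sqrt (2 * pi) * exp (- s\<^sup>2 / 2))" for s :: real
  proof -
    have "complex_of_real (exp (- s\<^sup>2 / 2)) = char std_normal_distribution s"
      by (simp add: char_std_normal_distribution)
    also have "\<dots> = (CLINT y|lborel. std_normal_density y *\<^sub>R iexp (s * y))"
      unfolding char_def by (rule integral_density) auto
    finally have "complex_of_real (sqrt (2 * pi) * exp (- s\<^sup>2 / 2))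
      = sqrt (2 * pi) * (CLINT y|lborel. std_normal_density y *\<^sub>R iexp (s * y))" by simp
    also have "\<dots> = (CLINT y|lborel. sqrt (2 * pi) * (std_normal_density y *\<^sub>R iexp (s * y)))"
      by (rule integral_mult_right_zero[symmetric])
    also have "\<dots> = (CLINT y|lborel. iexp (s * y) * complex_of_real (exp (- y\<^sup>2 / 2)))"
      unfolding gaussian_eq_std_normal
      by (intro Bochner_Integration.integral_cong refl) (simp add: scaleR_conv_of_real)
    finally show ?thesis ..
  qed
  have "fourier (\<lambda>x. complex_of_real (exp (- (e * x)\<^sup>2 / 2))) t
    = (CLINT x|lborel. iexp (t / e * (0 + e * x)) * complex_of_real (exp (- (0 + e * x)\<^sup>2 / 2)))"
    unfolding fourier_def using assms by simp
  also have "\<dots> = (CLINT y|lborel. iexp (t / e * y) * complex_of_real (exp (- y\<^sup>2 / 2))) / complex_of_real e"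
    using assms
    by (subst lborel_integral_real_affine[of e _ 0]) (auto simp: scaleR_conv_of_real)
  also have "\<dots> = complex_of_real (sqrt (2 * pi) / e * exp (- (t / e)\<^sup>2 / 2))"
    unfolding 1 by simp
  finally show ?thesis .
qed

section \<open>Plancherel's inequality and its weighted form\<close>

lemma nn_integral_le_of_tendsto:
  assumes "\<And>n::nat. f n \<in> borel_measurable M"
    and "\<And>x. (\<lambda>n. f n x) \<longlonglongrightarrow> g x"
    and "\<And>n. (\<integral>\<^sup>+x. f n x \<partial>M) \<le> (B::ennreal)"
  shows "(\<integral>\<^sup>+x. g x \<partial>M) \<le> B"
proof -
  have "(\<integral>\<^sup>+x. g x \<partial>M) = (\<integral>\<^sup>+x. liminf (\<lambda>n. f n x) \<partial>M)"
    by (intro nn_integral_cong lim_imp_Liminf[symmetric] assms(2)) simp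
  also have "\<dots> \<le> liminf (\<lambda>n. \<integral>\<^sup>+x. f n x \<partial>M)"
    by (rule nn_integral_liminf) (rule assms(1))
  also have "\<dots> \<le> B"
    by (rule order_trans[OF Liminf_mono[of _ "\<lambda>_. B"]]) (auto simp: assms(3) Liminf_const)
  finally show ?thesis .
qed

text \<open>If \<open>f\<close> is not integrable, its Bochner integral is 0 by convention, so the
  bound comes without a side condition.\<close>

lemma norm_integral_le_nn_integral:
  fixes f :: "'a \<Rightarrow> 'b::{banach, second_countable_topology}"
  shows "ennreal (norm (integral\<^sup>L M f)) \<le> (\<integral>\<^sup>+x. norm (f x) \<partial>M)"
  by (cases "integrable M f")
     (auto simp: integral_norm_bound_ennreal not_integrable_integral_eq)

lemma tendsto_inverse_Suc_mult: "(\<lambda>n. a * inverse (real (Suc n))) \<longlonglongrightarrow> 0"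
  by (rule tendsto_mult_right_zero) (rule LIMSEQ_inverse_real_of_nat)

lemma borel_measurable_cnj [measurable]:
  "f \<in> borel_measurable M \<Longrightarrow> (\<lambda>x. cnj (f x)) \<in> borel_measurable M"
  by (rule borel_measurable_continuous_on) (auto intro!: continuous_intros)

lemma fourier_cnj_reflect: "fourier (\<lambda>y. cnj (u (- y))) t = cnj (fourier u t)"
proof -
  have "fourier (\<lambda>y. cnj (u (- y))) t = (CLINT y|lborel. cnj (iexp (t * y) * u y))"
    unfolding fourier_def
    by (subst lborel_integral_real_affine[where c="-1" and t=0]) (auto simp: exp_cnj)
  also have "\<dots> = cnj (fourier u t)"
    unfolding fourier_def by (rule Bochner_Integration.integral_cnj)
  finally show ?thesis .
qed

text \<open>Damping \<open>|fourier u|\<^sup>2\<close> by a Gaussian turns its integral into a double integral against a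
  positive kernel of mass \<open>2\<pi>\<close>, which Schur's test bounds.\<close>

lemma plancherel_le:
  assumes u: "integrable lborel u"
  shows "(\<integral>\<^sup>+t. ennreal ((norm (fourier u t))\<^sup>2) \<partial>lborel)
    \<le> ennreal (2 * pi) * (\<integral>\<^sup>+x. ennreal ((norm (u x))\<^sup>2) \<partial>lborel)" (is "_ \<le> ?B")
proof -
  define A where "A = (\<integral>\<^sup>+x. ennreal ((norm (u x))\<^sup>2) \<partial>lborel)"
  have [measurable]: "u \<in> borel_measurable borel"
    using u by (auto dest: borel_measurable_integrable_lborel)
  have damped: "(\<integral>\<^sup>+t. ennreal (exp (- (e * t)\<^sup>2 / 2) * (norm (fourier u t))\<^sup>2) \<partial>lborel) \<le> ?B"
    if e: "e > 0" for e :: real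
  proof -
    \<comment> \<open>\<open>G\<close> is the Fourier transform of the weight \<open>w\<close>, and
      its mass 2 pi does not depend on \<open>e\<close>. The choice of \<open>v\<close> makes the
      integral of \<open>fourier u * v\<close> equal to the damped energy.\<close>
    define w where "w t = exp (- (e * t)\<^sup>2 / 2)" for t :: real
    define G where "G y = sqrt (2 * pi) / e * exp (- (1 / e * y)\<^sup>2 / 2)" for y :: real
    define v where "v t = complex_of_real (w t) * cnj (fourier u t)" for t
    define g where "g y = cnj (u (- y))" for y
    have [measurable]: "w \<in> borel_measurable borel" "G \<in> borel_measurable borel"
      "v \<in> borel_measurable borel" "g \<in> borel_measurable borel"
      unfolding w_def[abs_def] G_def[abs_def] v_def[abs_def] g_def[abs_def] by measurable
    have w: "integrable lborel w" unfolding w_def[abs_def] by (rule integrable_gaussian[OF e])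
    have w0: "w t \<ge> 0" for t by (simp add: w_def)
    have G0: "G y \<ge> 0" for y using e by (simp add: G_def)
    have G: "(\<integral>\<^sup>+y. ennreal (G y) \<partial>lborel) = ennreal (2 * pi)"
    proof -
      have "integrable lborel G"
        unfolding G_def[abs_def] using e by (intro integrable_mult_right integrable_gaussian) simp
      moreover have "integral\<^sup>L lborel G = 2 * pi"
        unfolding G_def[abs_def] integral_mult_right_zero using e
        by (subst integral_gaussian) auto
      ultimately show ?thesis using G0 by (simp add: nn_integral_eq_integral)
    qed
    have Gs: "(\<integral>\<^sup>+y. ennreal (G (y + x)) \<partial>lborel) = ennreal (2 * pi)"
      "(\<integral>\<^sup>+y. ennreal (G (x + y)) \<partial>lborel) = ennreal (2 * pi)" for x
      using nn_integral_real_affine[of "\<lambda>y. ennreal (G y)" 1 x] by (auto simp: G add.commute)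
    have wb: "integrable lborel (\<lambda>t. complex_of_real (w t) * z t)"
      if "\<And>t. norm (z t) \<le> C" and [measurable]: "z \<in> borel_measurable borel" for z :: "real \<Rightarrow> complex" and C
    proof (rule Bochner_Integration.integrable_bound)
      show "integrable lborel (\<lambda>t. C * w t)" using w by simp
      show "AE t in lborel. norm (complex_of_real (w t) * z t) \<le> norm (C * w t)"
      proof (rule AE_I2)
        fix t
        have "w t * norm (z t) \<le> w t * \<bar>C\<bar>"
          using that(1)[of t] w0[of t] by (intro mult_left_mono) auto
        then show "norm (complex_of_real (w t) * z t) \<le> norm (C * w t)"
          using w0[of t] by (simp add: norm_mult abs_mult mult.commute)
      qed
    qed measurable
    have v: "integrable lborel v"
      unfolding v_def[abs_def] by (rule wb[of _ "LINT x|lborel. norm (u x)"]) (auto simp: norm_fourier_le)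
    have g: "integrable lborel g"
      unfolding g_def[abs_def] using u lborel_integrable_real_affine[OF u, of "-1" 0] by simp
    have fv: "fourier v x = (CLINT y|lborel. g y * complex_of_real (G (y + x)))" for x
    proof -
      have "fourier v x = (CLINT t|lborel. fourier g t * (iexp (x * t) * complex_of_real (w t)))"
        unfolding fourier_def[of v] g_def[abs_def] fourier_cnj_reflect v_def by (simp add: ac_simps)
      also have "\<dots> = (CLINT y|lborel. g y * fourier (\<lambda>t. iexp (x * t) * complex_of_real (w t)) y)"
        by (rule fourier_multiplication[OF g]) (rule integrable_iexp_mult, use w in simp)
      also have "\<dots> = (CLINT y|lborel. g y * complex_of_real (G (y + x)))"
        unfolding fourier_modulate w_def[abs_def] fourier_gaussian[OF e] G_def by simp
      finally show ?thesis .
    qed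
    have "(\<integral>\<^sup>+t. ennreal (w t * (norm (fourier u t))\<^sup>2) \<partial>lborel)
      = ennreal (LINT t|lborel. w t * (norm (fourier u t))\<^sup>2)"
    proof (rule nn_integral_eq_integral)
      have "integrable lborel (\<lambda>t. complex_of_real (w t) * complex_of_real ((norm (fourier u t))\<^sup>2))"
        by (rule wb[of _ "(LINT x|lborel. norm (u x))\<^sup>2"]) (auto simp: power_mono norm_fourier_le norm_power)
      then have "integrable lborel (\<lambda>t. complex_of_real (w t * (norm (fourier u t))\<^sup>2))" by simp
      then show "integrable lborel (\<lambda>t. w t * (norm (fourier u t))\<^sup>2)"
        by (subst (asm) complex_of_real_integrable_eq)
    qed (simp add: w0)
    also have "(LINT t|lborel. w t * (norm (fourier u t))\<^sup>2) = norm (CLINT t|lborel. fourier u t * v t)"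
    proof -
      have "(CLINT t|lborel. fourier u t * v t) = (CLINT t|lborel. complex_of_real (w t * (norm (fourier u t))\<^sup>2))"
        by (intro Bochner_Integration.integral_cong refl)
           (simp only: v_def of_real_mult complex_norm_square ac_simps)
      then show ?thesis using w0 by (simp only: integral_complex_of_real norm_of_real) (simp add: integral_nonneg_AE)
    qed
    also have "(CLINT t|lborel. fourier u t * v t) = (CLINT x|lborel. u x * fourier v x)"
      by (rule fourier_multiplication[OF u v])
    also have "ennreal (norm \<dots>) \<le> (\<integral>\<^sup>+x. norm (u x * fourier v x) \<partial>lborel)"
      by (rule norm_integral_le_nn_integral)
    also have "\<dots> \<le> (\<integral>\<^sup>+x. \<integral>\<^sup>+y. ennreal (norm (u x) * (norm (g y) * G (y + x))) \<partial>lborel \<partial>lborel)"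
    proof (intro nn_integral_mono)
      fix x
      have "ennreal (norm (u x * fourier v x)) = ennreal (norm (u x)) * ennreal (norm (fourier v x))"
        by (simp add: norm_mult ennreal_mult)
      also have "ennreal (norm (fourier v x)) \<le> (\<integral>\<^sup>+y. ennreal (norm (g y) * G (y + x)) \<partial>lborel)"
        unfolding fv by (rule order_trans[OF norm_integral_le_nn_integral]) (simp add: norm_mult G0)
      also have "ennreal (norm (u x)) * \<dots> = (\<integral>\<^sup>+y. ennreal (norm (u x) * (norm (g y) * G (y + x))) \<partial>lborel)"
        by (subst nn_integral_cmult[symmetric]) (auto simp: ennreal_mult G0)
      finally show "ennreal (norm (u x * fourier v x)) \<le> \<dots>" by (simp add: mult_left_mono)
    qed
    \<comment> \<open>The arithmetic-geometric mean inequality separates \<open>u\<close> from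
      \<open>g\<close>. In each summand the variable that occurs only in \<open>G\<close> can then
      be integrated out.\<close>
    also have "\<dots> \<le> (\<integral>\<^sup>+x. \<integral>\<^sup>+y. ennreal ((norm (u x))\<^sup>2 / 2) * ennreal (G (y + x)) +
        ennreal ((norm (g y))\<^sup>2 / 2) * ennreal (G (y + x)) \<partial>lborel \<partial>lborel)"
    proof (intro nn_integral_mono)
      fix x y
      have "norm (u x) * norm (g y) \<le> (norm (u x))\<^sup>2 / 2 + (norm (g y))\<^sup>2 / 2"
        using sum_squares_bound[of "norm (u x)" "norm (g y)"] by simp
      then have "norm (u x) * norm (g y) * G (y + x) \<le> ((norm (u x))\<^sup>2 / 2 + (norm (g y))\<^sup>2 / 2) * G (y + x)"
        by (rule mult_right_mono) (rule G0)
      then show "ennreal (norm (u x) * (norm (g y) * G (y + x))) \<le> ennreal ((norm (u x))\<^sup>2 / 2) * ennreal (G (y + x)) +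
        ennreal ((norm (g y))\<^sup>2 / 2) * ennreal (G (y + x))"
        by (simp add: G0 algebra_simps flip: ennreal_mult ennreal_plus)
    qed
    also have "\<dots> = (\<integral>\<^sup>+x. \<integral>\<^sup>+y. ennreal ((norm (u x))\<^sup>2 / 2) * ennreal (G (y + x)) \<partial>lborel \<partial>lborel)
        + (\<integral>\<^sup>+x. \<integral>\<^sup>+y. ennreal ((norm (g y))\<^sup>2 / 2) * ennreal (G (y + x)) \<partial>lborel \<partial>lborel)"
      by (simp add: nn_integral_add)
    also have "(\<integral>\<^sup>+x. \<integral>\<^sup>+y. ennreal ((norm (u x))\<^sup>2 / 2) * ennreal (G (y + x)) \<partial>lborel \<partial>lborel)
        = (\<integral>\<^sup>+x. ennreal ((norm (u x))\<^sup>2 / 2) * ennreal (2 * pi) \<partial>lborel)"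
      by (intro nn_integral_cong, subst nn_integral_cmult) (auto simp: Gs)
    also have "(\<integral>\<^sup>+x. \<integral>\<^sup>+y. ennreal ((norm (g y))\<^sup>2 / 2) * ennreal (G (y + x)) \<partial>lborel \<partial>lborel)
        = (\<integral>\<^sup>+y. \<integral>\<^sup>+x. ennreal ((norm (g y))\<^sup>2 / 2) * ennreal (G (y + x)) \<partial>lborel \<partial>lborel)"
      by (rule lborel_pair.Fubini'[symmetric]) measurable
    also have "\<dots> = (\<integral>\<^sup>+x. ennreal ((norm (g x))\<^sup>2 / 2) * ennreal (2 * pi) \<partial>lborel)"
      by (intro nn_integral_cong, subst nn_integral_cmult) (auto simp: Gs)
    also have "\<dots> = (\<integral>\<^sup>+x. ennreal ((norm (u x))\<^sup>2 / 2) * ennreal (2 * pi) \<partial>lborel)"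
      by (subst nn_integral_real_affine[where c="-1" and t=0]) (auto simp: g_def)
    also have "\<dots> + \<dots> = ?B"
    proof -
      have "(\<integral>\<^sup>+x. ennreal ((norm (u x))\<^sup>2 / 2) * ennreal (2 * pi) \<partial>lborel)
          = (\<integral>\<^sup>+x. ennreal pi * ennreal ((norm (u x))\<^sup>2) \<partial>lborel)"
        by (intro nn_integral_cong) (simp flip: ennreal_mult)
      also have "\<dots> = ennreal pi * A" unfolding A_def by (rule nn_integral_cmult) measurable
      finally have *: "(\<integral>\<^sup>+x. ennreal ((norm (u x))\<^sup>2 / 2) * ennreal (2 * pi) \<partial>lborel) = ennreal pi * A" .
      have "ennreal (2 * pi) = ennreal pi + ennreal pi" by (simp flip: ennreal_plus)
      then show ?thesis unfolding * A_def[symmetric] by (simp add: distrib_right)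
    qed
    finally show ?thesis by (simp add: w_def)
  qed
  \<comment> \<open>The damped bound is uniform in \<open>e\<close>, so Fatou's lemma preserves it
    as \<open>e\<close> runs through 1 / (n + 1).\<close>
  show ?thesis
  proof (rule nn_integral_le_of_tendsto)
    fix n :: nat
    show "(\<integral>\<^sup>+t. ennreal (exp (- (inverse (real (Suc n)) * t)\<^sup>2 / 2) * (norm (fourier u t))\<^sup>2) \<partial>lborel) \<le> ?B"
      by (rule damped) simp
    show "(\<lambda>t. ennreal (exp (- (inverse (real (Suc n)) * t)\<^sup>2 / 2) * (norm (fourier u t))\<^sup>2))
      \<in> borel_measurable lborel" by measurable
  next
    fix t :: real
    have "(\<lambda>n. ennreal (exp (- (inverse (real (Suc n)) * t)\<^sup>2 / 2) * (norm (fourier u t))\<^sup>2))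
      \<longlonglongrightarrow> ennreal (exp (- 0\<^sup>2 / 2) * (norm (fourier u t))\<^sup>2)"
      using tendsto_inverse_Suc_mult[of t] by (intro tendsto_intros) (simp_all add: mult.commute)
    then show "(\<lambda>n. ennreal (exp (- (inverse (real (Suc n)) * t)\<^sup>2 / 2) * (norm (fourier u t))\<^sup>2))
      \<longlonglongrightarrow> ennreal ((norm (fourier u t))\<^sup>2)" by simp
  qed
qed

text \<open>The increment of \<open>u\<close> over a step d has transform (exp(-ixd) - 1) times that
  of \<open>u\<close>, and the modulus of this factor divided by d tends to |x|. So Plancherel for
  difference quotients and Fatou give the weight x^2. Increments replace derivatives because the
  tent has kinks.\<close>

lemma plancherel_derivative_le:
  assumes u: "integrable lborel u" and B: "B \<ge> 0"
    and diff: "\<And>d. 0 < d \<Longrightarrow> d \<le> 1 \<Longrightarrow>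
      (\<integral>\<^sup>+t. ennreal ((norm (u (t + d) - u t))\<^sup>2) \<partial>lborel) \<le> ennreal (d\<^sup>2 * B)"
  shows "(\<integral>\<^sup>+x. ennreal (x\<^sup>2 * (norm (fourier u x))\<^sup>2) \<partial>lborel) \<le> ennreal (2 * pi * B)"
proof (rule nn_integral_le_of_tendsto)
  have [measurable]: "u \<in> borel_measurable borel"
    using u by (auto dest: borel_measurable_integrable_lborel)
  define q where "q n x = norm ((iexp (x * - inverse (real (Suc n))) - 1) * complex_of_real (real (Suc n)))" for n x
  fix n :: nat
  define d where "d = inverse (real (Suc n))"
  have d: "0 < d" "d \<le> 1" by (auto simp: d_def field_simps)
  have qd: "q n x = norm (iexp (x * - d) - 1) / d" for x
    unfolding q_def norm_mult norm_of_real by (simp add: d_def divide_inverse)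
  show "(\<lambda>x. ennreal ((q n x * norm (fourier u x))\<^sup>2)) \<in> borel_measurable lborel"
    unfolding q_def by measurable
  have ud: "integrable lborel (\<lambda>t. u (t + d))"
    using lborel_integrable_real_affine[OF u, of 1 d] by (simp add: add.commute)
  have four: "fourier (\<lambda>t. u (t + d) - u t) x = (iexp (x * - d) - 1) * fourier u x" for x
  proof -
    have "fourier (\<lambda>t. u (t + d) - u t) x = fourier (\<lambda>t. u (t + d) + (-1) * u t) x" by simp
    also have "\<dots> = fourier (\<lambda>t. u (t - (- d))) x + (-1) * fourier u x"
      using u ud by (subst fourier_add) (auto simp: fourier_cmult[of "-1", simplified])
    also have "\<dots> = (iexp (x * - d) - 1) * fourier u x"
      unfolding fourier_shift by (simp only: left_diff_distrib) simp
    finally show ?thesis .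
  qed
  have "(\<integral>\<^sup>+x. ennreal ((q n x * norm (fourier u x))\<^sup>2) \<partial>lborel)
    = (\<integral>\<^sup>+x. ennreal (1 / d\<^sup>2) * ennreal ((norm (fourier (\<lambda>t. u (t + d) - u t) x))\<^sup>2) \<partial>lborel)"
    unfolding four qd using d
    by (intro nn_integral_cong) (simp add: norm_mult power_mult_distrib power_divide flip: ennreal_mult)
  also have "\<dots> = ennreal (1 / d\<^sup>2) * (\<integral>\<^sup>+x. ennreal ((norm (fourier (\<lambda>t. u (t + d) - u t) x))\<^sup>2) \<partial>lborel)"
    by (rule nn_integral_cmult) measurable
  also have "\<dots> \<le> ennreal (1 / d\<^sup>2) * (ennreal (2 * pi) * ennreal (d\<^sup>2 * B))"
    using u ud by (intro mult_left_mono order_trans[OF plancherel_le] diff d) auto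
  also have "\<dots> = ennreal (2 * pi * B)"
    using d B by (simp flip: ennreal_mult)
  finally show "(\<integral>\<^sup>+x. ennreal ((q n x * norm (fourier u x))\<^sup>2) \<partial>lborel) \<le> ennreal (2 * pi * B)" .
next
  fix x :: real
  define q where "q n x = norm ((iexp (x * - inverse (real (Suc n))) - 1) * complex_of_real (real (Suc n)))" for n x
  have "(\<lambda>n. q n x) \<longlonglongrightarrow> \<bar>x\<bar>"
  proof (cases "x = 0")
    case True
    then show ?thesis by (simp add: q_def)
  next
    case False
    define z where "z n = \<i> * complex_of_real (x * - inverse (real (Suc n)))" for n
    have "(\<lambda>n. x * - inverse (real (Suc n))) \<longlonglongrightarrow> 0"
      using tendsto_inverse_Suc_mult[of "- x"] by simp
    then have "(\<lambda>n. \<i> * complex_of_real (x * - inverse (real (Suc n)))) \<longlonglongrightarrow> \<i> * complex_of_real 0"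
      by (intro tendsto_intros)
    then have z0: "z \<longlonglongrightarrow> 0" by (simp add: z_def[abs_def])
    have "filterlim z (at 0) sequentially"
      using z0 False by (auto simp: filterlim_at z_def simp del: of_nat_Suc)
    then have "(\<lambda>n. (exp (z n) - 1) / z n) \<longlonglongrightarrow> 1"
      by (rule filterlim_compose[OF lim_exp_minus_1])
    then have "(\<lambda>n. norm ((exp (z n) - 1) / z n) * \<bar>x\<bar>) \<longlonglongrightarrow> norm (1::complex) * \<bar>x\<bar>"
      by (intro tendsto_intros)
    moreover have "norm ((exp (z n) - 1) / z n) * \<bar>x\<bar> = q n x" for n
      using False by (simp add: q_def z_def norm_mult norm_divide abs_mult field_simps)
    ultimately show ?thesis by simp
  qed
  then have "(\<lambda>n. ennreal ((q n x * norm (fourier u x))\<^sup>2)) \<longlonglongrightarrow> ennreal ((\<bar>x\<bar> * norm (fourier u x))\<^sup>2)"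
    by (intro tendsto_intros)
  then show "(\<lambda>n. ennreal ((q n x * norm (fourier u x))\<^sup>2)) \<longlonglongrightarrow> ennreal (x\<^sup>2 * (norm (fourier u x))\<^sup>2)"
    by (simp add: power_mult_distrib)
qed

section \<open>The Fejer kernel and the perturbed densities\<close>

definition tent :: "real \<Rightarrow> real" where
  "tent t = max 0 (1 - \<bar>t\<bar>)"

lemma tent_nonneg: "0 \<le> tent t"
  and tent_le_1: "tent t \<le> 1"
  and tent_minus: "tent (- t) = tent t"
  and tent_eq_0: "1 \<le> \<bar>t\<bar> \<Longrightarrow> tent t = 0"
  and tent_diff_le: "\<bar>tent s - tent t\<bar> \<le> \<bar>s - t\<bar>"
  by (auto simp: tent_def)

lemma tendsto_tent [tendsto_intros]:
  "(f \<longlongrightarrow> l) F \<Longrightarrow> ((\<lambda>x. tent (f x)) \<longlongrightarrow> tent l) F"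
  unfolding tent_def by (intro tendsto_intros)

lemma borel_measurable_tent [measurable]: "tent \<in> borel_measurable borel"
  unfolding tent_def[abs_def] by measurable

lemma integrable_tent: "integrable lborel tent"
proof (rule Bochner_Integration.integrable_bound)
  show "integrable lborel (indicator {-1..1::real} :: real \<Rightarrow> real)" by simp
qed (auto simp: tent_def split: split_indicator)

text \<open>The Fejer kernel; its value at \<open>0\<close> is the junk value \<open>0\<close> of division, which
  is harmless because only its almost-everywhere class matters.\<close>

definition fejer :: "real \<Rightarrow> real" where
  "fejer x = (1 - cos x) / (pi * x\<^sup>2)"

lemma borel_measurable_fejer [measurable]: "fejer \<in> borel_measurable borel"
  unfolding fejer_def[abs_def] by measurable

lemma fejer_nonneg: "0 \<le> fejer x"
  by (simp add: fejer_def)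

text \<open>Near 0 one uses 1 - cos x \<le> x^2 / 2, far out 1 - cos x \<le> 2. Added up they give
  at most 3 x^2, which the factor pi in the denominator absorbs.\<close>

lemma fejer_le: "fejer x \<le> 1 / (1 + x\<^sup>2)"
proof (cases "x = 0")
  case False
  have "(sin (x / 2))\<^sup>2 \<le> (x / 2)\<^sup>2"
    using abs_sin_x_le_abs_x[of "x / 2"] by (simp only: abs_le_square_iff)
  then have "1 - cos x \<le> x\<^sup>2 / 2"
    using cos_double_sin[of "x / 2"] by (simp add: power_divide)
  moreover have "(1 - cos x) * x\<^sup>2 \<le> 2 * x\<^sup>2"
    using cos_ge_minus_one[of x] by (intro mult_right_mono) auto
  ultimately have "(1 - cos x) * (1 + x\<^sup>2) \<le> 3 * x\<^sup>2"
    unfolding distrib_left mult_1_right using zero_le_power2[of x] by argo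
  also have "\<dots> \<le> pi * x\<^sup>2" using pi_gt3 by (intro mult_right_mono) auto
  finally have "(1 - cos x) * (1 + x\<^sup>2) \<le> pi * x\<^sup>2" .
  moreover have "0 < pi * x\<^sup>2" "0 < 1 + x\<^sup>2" using False by (auto simp: add_pos_nonneg)
  ultimately show ?thesis unfolding fejer_def by (simp add: divide_simps)
qed (simp add: fejer_def)

lemma fejer_le_1: "fejer x \<le> 1"
  by (rule order_trans[OF fejer_le]) (simp add: divide_simps add_pos_nonneg)

lemma fejer_ge: "(1 - cos x) / (2 * pi * (1 + x\<^sup>2)) \<le> fejer x"
  "(1 - cos (x - 1)) / (2 * pi * (1 + x\<^sup>2)) \<le> fejer (x - 1)"
proof -
  have *: "(1 - cos y) / (2 * pi * (1 + x\<^sup>2)) \<le> fejer y" if "y\<^sup>2 \<le> 2 * (1 + x\<^sup>2)" for y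
  proof (cases "y = 0")
    case False
    have "(1 - cos y) / (pi * (2 * (1 + x\<^sup>2))) \<le> (1 - cos y) / (pi * y\<^sup>2)"
      using that False by (intro divide_left_mono mult_left_mono mult_pos_pos) (auto simp: add_pos_nonneg)
    then show ?thesis by (simp add: fejer_def mult_ac)
  qed (simp add: fejer_def)
  show "(1 - cos x) / (2 * pi * (1 + x\<^sup>2)) \<le> fejer x" by (rule *) simp
  have "(x - 1)\<^sup>2 + (x + 1)\<^sup>2 = 2 * (1 + x\<^sup>2)" by (simp add: power2_eq_square algebra_simps)
  then have "(x - 1)\<^sup>2 \<le> 2 * (1 + x\<^sup>2)" using zero_le_power2[of "x + 1"] by linarith
  then show "(1 - cos (x - 1)) / (2 * pi * (1 + x\<^sup>2)) \<le> fejer (x - 1)" by (rule *)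
qed

lemma integrable_fejer: "integrable lborel fejer"
proof (rule Bochner_Integration.integrable_bound)
  show "integrable lborel (\<lambda>x::real. inverse (1 + x\<^sup>2))"
    using integrable_inverse_1_plus_square by (simp add: set_integrable_def)
  show "AE x in lborel. norm (fejer x) \<le> norm (inverse (1 + x\<^sup>2))"
    using fejer_le fejer_nonneg by (auto simp: inverse_eq_divide add_pos_nonneg abs_of_nonneg)
qed measurable

text \<open>The point 0 is excluded because \<open>fejer 0\<close> is 0 by convention, while the
  tent has integral 1.\<close>

lemma fourier_tent:
  assumes x: "x \<noteq> 0"
  shows "fourier (\<lambda>t. complex_of_real (tent t)) x = complex_of_real (2 * pi * fejer x)"
proof -
  define E where "E t = iexp (x * t)" for t
  have E: "(E has_vector_derivative (\<i> * x * E t)) (at t within S)" for t S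
    unfolding E_def by (auto intro!: derivative_eq_intros has_vector_derivative_real_field simp: mult_ac)
  have cE: "continuous_on S E" for S unfolding E_def by (intro continuous_intros)
  \<comment> \<open>The antiderivatives on the two halves come from one integration by
    parts.\<close>
  have 1: "has_bochner_integral lborel (\<lambda>t. indicator {0..1} t *\<^sub>R ((1 - t) * E t))
     ((complex_of_real (1 - 1) * E 1 / (\<i> * x) - E 1 / (x * x)) - (complex_of_real (1 - 0) * E 0 / (\<i> * x) - E 0 / (x * x)))"
    by (rule has_bochner_integral_FTC_Icc)
       (use x in \<open>auto intro!: derivative_eq_intros E continuous_intros cE simp: field_simps\<close>)
  have 2: "has_bochner_integral lborel (\<lambda>t. indicator {-1..0} t *\<^sub>R ((1 + t) * E t))
     ((complex_of_real (1 + 0) * E 0 / (\<i> * x) + E 0 / (x * x)) - (complex_of_real (1 + (-1)) * E (-1) / (\<i> * x) + E (-1) / (x * x)))"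
    by (rule has_bochner_integral_FTC_Icc)
       (use x in \<open>auto intro!: derivative_eq_intros E continuous_intros cE simp: field_simps\<close>)
  have "fourier (\<lambda>t. complex_of_real (tent t)) x =
    (CLINT t|lborel. indicator {-1..0} t *\<^sub>R ((1 + t) * E t) + indicator {0..1} t *\<^sub>R ((1 - t) * E t))"
    unfolding fourier_def
  proof (rule integral_cong_AE)
    show "AE t in lborel. iexp (x * t) * complex_of_real (tent t) =
      indicator {-1..0} t *\<^sub>R ((1 + t) * E t) + indicator {0..1} t *\<^sub>R ((1 - t) * E t)"
      using AE_lborel_singleton[of "0::real"]
      by eventually_elim (auto simp: tent_def E_def max_def split: split_indicator)
  qed (auto simp: E_def)
  also have "\<dots> = (2 * E 0 - E 1 - E (-1)) / (x * x)"
    using has_bochner_integral_integral_eq[OF has_bochner_integral_add[OF 2 1]] x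
    by (simp add: diff_divide_distrib add_divide_distrib)
  also have "E 1 + E (-1) = complex_of_real (2 * cos x)"
    using cis_conv_exp[of x] cis_conv_exp[of "- x"] by (simp add: E_def complex_eq_iff)
  then have "(2 * E 0 - E 1 - E (-1)) = complex_of_real (2 - 2 * cos x)"
    by (simp add: E_def algebra_simps)
  finally show ?thesis
    by (simp add: fejer_def power2_eq_square)
qed

text \<open>Fourier inversion for the tent function, by Gaussian regularisation.\<close>

lemma fourier_fejer: "fourier (\<lambda>x. complex_of_real (fejer x)) t = complex_of_real (tent t)"
proof (rule LIMSEQ_unique)
  define w where "w n x = exp (- (inverse (real (Suc n)) * x)\<^sup>2 / 2)" for n x
  define X where "X n = (CLINT x|lborel. complex_of_real (w n x) * (iexp (t * x) * complex_of_real (fejer x)))" for n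
  show "X \<longlonglongrightarrow> fourier (\<lambda>x. complex_of_real (fejer x)) t"
    unfolding X_def fourier_def
  proof (rule integral_dominated_convergence[where w=fejer])
    show "AE x in lborel. (\<lambda>n. complex_of_real (w n x) * (iexp (t * x) * complex_of_real (fejer x)))
      \<longlonglongrightarrow> iexp (t * x) * complex_of_real (fejer x)"
    proof (rule AE_I2)
      fix x :: real
      have "(\<lambda>n. w n x) \<longlonglongrightarrow> exp (- 0\<^sup>2 / 2)" unfolding w_def
        using tendsto_inverse_Suc_mult[of x] by (intro tendsto_intros) (simp_all add: mult.commute)
      then have "(\<lambda>n. complex_of_real (w n x) * (iexp (t * x) * complex_of_real (fejer x)))
        \<longlonglongrightarrow> complex_of_real (exp (- 0\<^sup>2 / 2)) * (iexp (t * x) * complex_of_real (fejer x))"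
        by (intro tendsto_intros)
      then show "(\<lambda>n. complex_of_real (w n x) * (iexp (t * x) * complex_of_real (fejer x)))
        \<longlonglongrightarrow> iexp (t * x) * complex_of_real (fejer x)" by simp
    qed
    show "AE x in lborel. norm (complex_of_real (w n x) * (iexp (t * x) * complex_of_real (fejer x))) \<le> fejer x" for n
      using fejer_nonneg by (auto simp: norm_mult w_def intro!: mult_left_le_one_le)
  qed (auto simp: w_def integrable_fejer)
  have "X n = (CLINT y|lborel. complex_of_real (std_normal_density y * tent (- t + inverse (real (Suc n)) * y)))" for n
  proof -
    define e where "e = inverse (real (Suc n))"
    have e: "e > 0" by (simp add: e_def)
    have "X n = (CLINT x|lborel. fourier (\<lambda>t. complex_of_real (tent t)) x *
        (iexp (t * x) * complex_of_real (w n x))) / (2 * pi)"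
    proof -
      have "X n = (CLINT x|lborel. fourier (\<lambda>t. complex_of_real (tent t)) x *
        (iexp (t * x) * complex_of_real (w n x)) / (2 * pi))" unfolding X_def
      proof (rule integral_cong_AE)
        show "AE x in lborel. complex_of_real (w n x) * (iexp (t * x) * complex_of_real (fejer x)) =
           fourier (\<lambda>t. complex_of_real (tent t)) x * (iexp (t * x) * complex_of_real (w n x)) / (2 * pi)"
          using AE_lborel_singleton[of "0::real"] by eventually_elim (simp add: fourier_tent)
      qed (auto simp: w_def)
      then show ?thesis by simp
    qed
    also have "(CLINT x|lborel. fourier (\<lambda>t. complex_of_real (tent t)) x * (iexp (t * x) * complex_of_real (w n x)))
      = (CLINT s|lborel. tent s * fourier (\<lambda>x. iexp (t * x) * complex_of_real (w n x)) s)"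
      using integrable_tent integrable_gaussian[OF e]
      by (intro fourier_multiplication integrable_iexp_mult) (auto simp: w_def e_def simp del: of_nat_Suc)
    also have "\<dots> = (CLINT s|lborel. complex_of_real (tent s * (sqrt (2 * pi) / e * exp (- ((s + t) / e)\<^sup>2 / 2))))"
      unfolding fourier_modulate w_def[abs_def] e_def[symmetric] fourier_gaussian[OF e] by simp
    \<comment> \<open>The substitution s = -t + e y turns the shrinking Gaussian into a fixed one
      and moves \<open>e\<close> inside the tent, where dominated convergence can remove it.\<close>
    also have "\<dots> = e *\<^sub>R (CLINT y|lborel. complex_of_real (tent (- t + e * y) * (sqrt (2 * pi) / e * exp (- y\<^sup>2 / 2))))"
      using e by (subst lborel_integral_real_affine[where c=e and t="- t"]) auto
    also have "\<dots> / (2 * pi) = (CLINT y|lborel. e / (2 * pi) * complex_of_real (tent (- t + e * y) * (sqrt (2 * pi) / e * exp (- y\<^sup>2 / 2))))"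
      by (simp add: scaleR_conv_of_real)
    also have "\<dots> = (CLINT y|lborel. complex_of_real (std_normal_density y * tent (- t + e * y)))"
    proof (intro Bochner_Integration.integral_cong refl)
      fix y
      have "e / (2 * pi) * (tent (- t + e * y) * (sqrt (2 * pi) / e * exp (- y\<^sup>2 / 2)))
         = (sqrt (2 * pi) * sqrt (2 * pi)) / (2 * pi) * (std_normal_density y * tent (- t + e * y))"
        using e unfolding gaussian_eq_std_normal by (simp add: field_simps)
      then have "e / (2 * pi) * (tent (- t + e * y) * (sqrt (2 * pi) / e * exp (- y\<^sup>2 / 2)))
         = std_normal_density y * tent (- t + e * y)" by simp
      then show "e / (2 * pi) * complex_of_real (tent (- t + e * y) * (sqrt (2 * pi) / e * exp (- y\<^sup>2 / 2)))
         = complex_of_real (std_normal_density y * tent (- t + e * y))"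
        by (metis of_real_mult)
    qed
    finally show ?thesis by (simp only: e_def)
  qed
  then have "X = (\<lambda>n. CLINT y|lborel. complex_of_real (std_normal_density y * tent (- t + inverse (real (Suc n)) * y)))"
    by (rule ext)
  moreover have "(\<lambda>n. CLINT y|lborel. complex_of_real (std_normal_density y * tent (- t + inverse (real (Suc n)) * y)))
    \<longlonglongrightarrow> (CLINT y|lborel. complex_of_real (std_normal_density y * tent (- t + 0)))"
  proof (rule integral_dominated_convergence[where w=std_normal_density])
    show "AE y in lborel. (\<lambda>n. complex_of_real (std_normal_density y * tent (- t + inverse (real (Suc n)) * y)))
      \<longlonglongrightarrow> complex_of_real (std_normal_density y * tent (- t + 0))"
      using tendsto_inverse_Suc_mult by (intro AE_I2 tendsto_intros) (simp add: mult.commute)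
    show "AE y in lborel. norm (complex_of_real (std_normal_density y * tent (- t + inverse (real (Suc n)) * y)))
      \<le> std_normal_density y" for n
      unfolding norm_of_real abs_mult
      by (intro AE_I2) (simp add: tent_nonneg tent_le_1 mult_right_le_one_le)
  qed auto
  ultimately show "X \<longlonglongrightarrow> complex_of_real (tent t)"
    by (simp add: tent_minus integral_complex_of_real del: of_real_mult)
qed

section \<open>Modulated Fejer kernels and their disjoint spectra\<close>

definition bump :: "nat \<Rightarrow> real \<Rightarrow> real" where
  "bump j x = fejer x * cos (2 * real j * x)"

text \<open>The transform of \<open>bump j\<close>, see \<open>fourier_bump\<close>. Centres at even
  integers are as far apart as a tent is wide, so distinct spectra meet at most in points where both
  vanish.\<close>

definition bump_hat :: "nat \<Rightarrow> real \<Rightarrow> real" where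
  "bump_hat j t = (tent (t - 2 * real j) + tent (t + 2 * real j)) / 2"

lemma borel_measurable_bump [measurable]: "bump j \<in> borel_measurable borel"
  unfolding bump_def[abs_def] by measurable

lemma borel_measurable_bump_hat [measurable]: "bump_hat j \<in> borel_measurable borel"
  unfolding bump_hat_def[abs_def] by measurable

lemma abs_bump_le: "\<bar>bump j x\<bar> \<le> fejer x"
  unfolding bump_def abs_mult using fejer_nonneg[of x] by (simp add: mult_left_le)

lemma integrable_bump: "integrable lborel (bump j)"
  by (rule Bochner_Integration.integrable_bound[OF integrable_fejer])
     (use abs_bump_le fejer_nonneg in auto)

lemma cos_eq_iexp: "complex_of_real (cos y) = (iexp y + iexp (- y)) / 2"
  using cis_conv_exp[of y] cis_conv_exp[of "- y"] by (simp add: complex_eq_iff)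

lemma complex_bump_eq: "complex_of_real (bump j x) = 1 / 2 * (iexp (2 * real j * x) * complex_of_real (fejer x))
    + 1 / 2 * (iexp (- (2 * real j) * x) * complex_of_real (fejer x))"
  unfolding bump_def of_real_mult[of "fejer x"] cos_eq_iexp by (simp add: algebra_simps)

lemma fourier_bump: "fourier (\<lambda>x. complex_of_real (bump j x)) t = complex_of_real (bump_hat j t)"
proof -
  have int: "integrable lborel (\<lambda>x. 1 / 2 * (iexp (s * x) * complex_of_real (fejer x)))" for s
    using integrable_fejer by (intro integrable_mult_right integrable_iexp_mult) simp
  show ?thesis
    unfolding complex_bump_eq fourier_add[OF int int] fourier_cmult fourier_modulate fourier_fejer
    by (simp add: bump_hat_def)
qed

lemma bump_hat_nonneg: "0 \<le> bump_hat j t"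
  unfolding bump_hat_def using tent_nonneg by simp

lemma bump_hat_le_1: "bump_hat j t \<le> 1"
  unfolding bump_hat_def using tent_le_1[of "t - 2 * real j"] tent_le_1[of "t + 2 * real j"] by simp

text \<open>Since j is nonnegative, the distance of |t| from 2j is the smaller of the distances of t
  from 2j and from -2j, so one condition covers both lobes.\<close>

lemma bump_hat_eq_0: "1 \<le> \<bar>\<bar>t\<bar> - 2 * real j\<bar> \<Longrightarrow> bump_hat j t = 0"
  unfolding bump_hat_def by (subst (1 2) tent_eq_0) auto

lemma bump_hat_diff_le: "\<bar>bump_hat j s - bump_hat j t\<bar> \<le> \<bar>s - t\<bar>"
  using tent_diff_le[of "s - 2 * real j" "t - 2 * real j"] tent_diff_le[of "s + 2 * real j" "t + 2 * real j"]
  unfolding bump_hat_def by (simp add: field_simps abs_if split: if_splits)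

lemma bump_hat_disjoint: "i \<noteq> j \<Longrightarrow> bump_hat i t * bump_hat j t = 0"
proof -
  assume "i \<noteq> j"
  then have "1 \<le> \<bar>real i - real j\<bar>" by linarith
  then have "1 \<le> \<bar>\<bar>t\<bar> - 2 * real i\<bar> \<or> 1 \<le> \<bar>\<bar>t\<bar> - 2 * real j\<bar>" by linarith
  then show ?thesis using bump_hat_eq_0 by auto
qed

lemma sum_bump_hat_square:
  assumes "finite J"
  shows "(\<Sum>j\<in>J. c j * bump_hat j t)\<^sup>2 = (\<Sum>j\<in>J. (c j)\<^sup>2 * (bump_hat j t)\<^sup>2)"
proof -
  have "(\<Sum>j\<in>J. c j * bump_hat j t)\<^sup>2 = (\<Sum>i\<in>J. \<Sum>j\<in>J. c i * c j * (bump_hat i t * bump_hat j t))"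
    unfolding power2_eq_square sum_product by (simp add: ac_simps)
  also have "\<dots> = (\<Sum>i\<in>J. \<Sum>j\<in>J. if j = i then (c i)\<^sup>2 * (bump_hat i t)\<^sup>2 else 0)"
    by (intro sum.cong refl) (auto simp: bump_hat_disjoint power2_eq_square)
  also have "\<dots> = (\<Sum>i\<in>J. (c i)\<^sup>2 * (bump_hat i t)\<^sup>2)" using assms by simp
  finally show ?thesis .
qed

text \<open>On the interval of length 1 around 2j the tent is at least 1/2, hence
  \<open>bump_hat\<close> at least 1/4.\<close>

lemma nn_integral_bump_hat_square_ge:
  "ennreal (1 / 16) \<le> (\<integral>\<^sup>+t. ennreal ((bump_hat j t)\<^sup>2) \<partial>lborel)"
proof -
  have "ennreal (1 / 16) = (\<integral>\<^sup>+t. ennreal (1 / 16) * indicator {2 * real j - 1 / 2..2 * real j + 1 / 2} t \<partial>lborel)"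
    by (subst nn_integral_cmult) auto
  also have "\<dots> \<le> (\<integral>\<^sup>+t. ennreal ((bump_hat j t)\<^sup>2) \<partial>lborel)"
  proof (intro nn_integral_mono)
    fix t :: real
    have "1 / 16 \<le> (bump_hat j t)\<^sup>2" if "2 * real j - 1 / 2 \<le> t" "t \<le> 2 * real j + 1 / 2"
    proof -
      have "1 / 2 \<le> tent (t - 2 * real j)" using that by (simp add: tent_def max_def abs_if field_simps)
      then have "1 / 4 \<le> bump_hat j t" using tent_nonneg[of "t + 2 * real j"] by (simp add: bump_hat_def)
      then have "(1 / 4)\<^sup>2 \<le> (bump_hat j t)\<^sup>2" by (intro power_mono) auto
      then show ?thesis by (simp add: power2_eq_square)
    qed
    then show "ennreal (1 / 16) * indicator {2 * real j - 1 / 2..2 * real j + 1 / 2} t \<le> ennreal ((bump_hat j t)\<^sup>2)"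
      by (auto intro!: ennreal_leI split: split_indicator simp del: ennreal_divide_numeral)
  qed
  finally show ?thesis .
qed

lemma nn_integral_near_frequency_le:
  assumes "0 \<le> r"
  shows "(\<integral>\<^sup>+t. indicator {t. \<bar>\<bar>t\<bar> - 2 * real j\<bar> \<le> r} t \<partial>lborel) \<le> ennreal (4 * r)"
proof -
  have "(\<integral>\<^sup>+t. indicator {t. \<bar>\<bar>t\<bar> - 2 * real j\<bar> \<le> r} t \<partial>lborel) \<le>
     (\<integral>\<^sup>+t. indicator {2 * real j - r..2 * real j + r} t + indicator {- (2 * real j) - r..- (2 * real j) + r} t \<partial>lborel)"
    by (intro nn_integral_mono) (auto split: split_indicator simp: abs_if split: if_splits)
  also have "\<dots> = ennreal (2 * r) + ennreal (2 * r)"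
    using assms by (subst nn_integral_add) auto
  also have "\<dots> = ennreal (4 * r)" using assms by (simp flip: ennreal_plus)
  finally show ?thesis .
qed

lemma nn_integral_bump_hat_weighted_le:
  assumes "j \<le> N" "0 \<le> \<alpha>"
  shows "(\<integral>\<^sup>+t. ennreal ((bump_hat j t)\<^sup>2 * (1 + \<bar>t\<bar> powr (2 * \<alpha>))) \<partial>lborel)
    \<le> ennreal (4 * (1 + (2 * real N + 1) powr (2 * \<alpha>)))"
proof -
  define C where "C = 1 + (2 * real N + 1) powr (2 * \<alpha>)"
  have "(\<integral>\<^sup>+t. ennreal ((bump_hat j t)\<^sup>2 * (1 + \<bar>t\<bar> powr (2 * \<alpha>))) \<partial>lborel)
    \<le> (\<integral>\<^sup>+t. ennreal C * indicator {t. \<bar>\<bar>t\<bar> - 2 * real j\<bar> \<le> 1} t \<partial>lborel)"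
  proof (intro nn_integral_mono)
    fix t :: real
    show "ennreal ((bump_hat j t)\<^sup>2 * (1 + \<bar>t\<bar> powr (2 * \<alpha>))) \<le> ennreal C * indicator {t. \<bar>\<bar>t\<bar> - 2 * real j\<bar> \<le> 1} t"
    proof (cases "\<bar>\<bar>t\<bar> - 2 * real j\<bar> \<le> 1")
      case True
      then have "\<bar>t\<bar> \<le> 2 * real N + 1" using assms(1) by (simp add: abs_if split: if_splits)
      then have "1 + \<bar>t\<bar> powr (2 * \<alpha>) \<le> C" unfolding C_def using assms(2) by (intro add_left_mono powr_mono2) auto
      moreover have "(bump_hat j t)\<^sup>2 \<le> 1" using bump_hat_nonneg[of j t] bump_hat_le_1[of j t] by (simp add: power_le_one)
      ultimately have "(bump_hat j t)\<^sup>2 * (1 + \<bar>t\<bar> powr (2 * \<alpha>)) \<le> 1 * C" by (intro mult_mono) auto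
      then show ?thesis using True by (simp add: ennreal_leI)
    qed (simp add: bump_hat_eq_0)
  qed
  also have "\<dots> = ennreal C * (\<integral>\<^sup>+t. indicator {t. \<bar>\<bar>t\<bar> - 2 * real j\<bar> \<le> 1} t \<partial>lborel)"
    by (rule nn_integral_cmult) measurable
  also have "\<dots> \<le> ennreal C * ennreal (4 * 1)"
    by (intro mult_left_mono nn_integral_near_frequency_le) auto
  also have "\<dots> = ennreal (4 * C)" by (subst ennreal_mult[symmetric]) (auto simp: C_def mult.commute)
  finally show ?thesis by (simp add: C_def)
qed

section \<open>A base density with tails of order 1 / (1 + x^2)\<close>

definition base_density :: "real \<Rightarrow> real" where
  "base_density x = (fejer x + fejer (x - 1)) / 2"

lemma borel_measurable_base_density [measurable]: "base_density \<in> borel_measurable borel"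
  unfolding base_density_def[abs_def] by measurable

lemma fejer_le_base_density: "fejer x \<le> 2 * base_density x"
  using fejer_nonneg[of "x - 1"] by (simp add: base_density_def)

lemma base_density_nonneg: "0 \<le> base_density x"
  using fejer_nonneg[of "x - 1"] fejer_nonneg[of x] by (simp add: base_density_def)

lemma base_density_le_1: "base_density x \<le> 1"
  using fejer_le_1[of "x - 1"] fejer_le_1[of x] by (simp add: base_density_def)

text \<open>The two Fejer kernels have no common zero: \<open>cos x + cos (x - 1) \<le> 2 cos (1/2)\<close>.\<close>

lemma base_density_ge:
  "(1 - cos (1 / 2)) / (2 * pi) / (1 + x\<^sup>2) \<le> base_density x"
proof -
  have "cos x + cos (x - 1) = cos ((x - 1 / 2) + 1 / 2) + cos ((x - 1 / 2) - 1 / 2)"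
    by simp
  also have "\<dots> = 2 * (cos (x - 1 / 2) * cos (1 / 2))"
    unfolding cos_add[of "x - 1 / 2"] cos_diff[of "x - 1 / 2"] by linarith
  also have "cos (x - 1 / 2) * cos (1 / 2) \<le> 1 * cos (1 / 2)"
    by (intro mult_right_mono cos_le_one cos_ge_zero) (use pi_gt3 in auto)
  finally have "2 * (1 - cos (1 / 2)) \<le> (1 - cos x) + (1 - cos (x - 1))" by simp
  then have "2 * (1 - cos (1 / 2)) / (2 * pi * (1 + x\<^sup>2)) \<le> ((1 - cos x) + (1 - cos (x - 1))) / (2 * pi * (1 + x\<^sup>2))"
    by (intro divide_right_mono) (auto simp: add_pos_nonneg)
  also have "\<dots> \<le> 2 * base_density x"
    using add_mono[OF fejer_ge[of x]] by (simp only: base_density_def add_divide_distrib) simp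
  finally show ?thesis unfolding divide_divide_eq_left times_divide_eq_right[symmetric] by linarith
qed

lemma cos_half_less_1: "cos (1 / 2 :: real) < 1"
  using cos_monotone_0_pi[of 0 "1 / 2"] pi_gt3 by simp

lemma integrable_base_density: "integrable lborel base_density"
proof -
  have "integrable lborel (\<lambda>x. fejer (x - 1))"
    using lborel_integrable_real_affine[OF integrable_fejer, of 1 "-1"] by simp
  then show ?thesis unfolding base_density_def[abs_def] using integrable_fejer by simp
qed

lemma norm_fourier_base_density:
  "norm (fourier (\<lambda>x. complex_of_real (base_density x)) t) \<le> tent t"
  and fourier_base_density_0: "fourier (\<lambda>x. complex_of_real (base_density x)) 0 = 1"
proof -
  have int: "integrable lborel (\<lambda>x. 1 / 2 * complex_of_real (fejer x))"
    using integrable_fejer by simp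
  have int': "integrable lborel (\<lambda>x. 1 / 2 * complex_of_real (fejer (x - 1)))"
    using lborel_integrable_real_affine[OF integrable_fejer, of 1 "-1"] by simp
  have "(\<lambda>x. complex_of_real (base_density x)) = (\<lambda>x. 1 / 2 * complex_of_real (fejer x) + 1 / 2 * complex_of_real (fejer (x - 1)))"
    by (simp add: base_density_def add_divide_distrib)
  then have eq: "fourier (\<lambda>x. complex_of_real (base_density x)) t
      = 1 / 2 * complex_of_real (tent t) + 1 / 2 * (iexp (t * 1) * complex_of_real (tent t))" for t
    unfolding fourier_shift[of "\<lambda>x. complex_of_real (fejer x)" 1, unfolded fourier_fejer, symmetric]
    by (simp only: fourier_add[OF int int'] fourier_cmult fourier_fejer)
  have "norm (fourier (\<lambda>x. complex_of_real (base_density x)) t)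
    \<le> norm (1 / 2 * complex_of_real (tent t)) + norm (1 / 2 * (iexp (t * 1) * complex_of_real (tent t)))"
    unfolding eq by (rule norm_triangle_ineq)
  also have "\<dots> = tent t" using tent_nonneg[of t] by (simp add: norm_mult)
  finally show "norm (fourier (\<lambda>x. complex_of_real (base_density x)) t) \<le> tent t" .
  show "fourier (\<lambda>x. complex_of_real (base_density x)) 0 = 1"
    unfolding eq by (simp add: tent_def)
qed

section \<open>The perturbed densities: positivity, smoothness, separation\<close>

definition perturbed :: "real \<Rightarrow> nat set \<Rightarrow> real \<Rightarrow> real" where
  "perturbed a T x = base_density x + a * (\<Sum>j\<in>T. bump j x)"

lemma borel_measurable_perturbed [measurable]: "perturbed a T \<in> borel_measurable borel"
  unfolding perturbed_def[abs_def] by measurable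

lemma integrable_perturbed: "integrable lborel (perturbed a T)"
  unfolding perturbed_def[abs_def]
  by (intro Bochner_Integration.integrable_add integrable_base_density integrable_mult_right
      Bochner_Integration.integrable_sum integrable_bump)

lemma fourier_sum_bump:
  "fourier (\<lambda>x. complex_of_real (\<Sum>j\<in>J. c j * bump j x)) t = complex_of_real (\<Sum>j\<in>J. c j * bump_hat j t)"
proof -
  have "fourier (\<lambda>x. complex_of_real (\<Sum>j\<in>J. c j * bump j x)) t
    = fourier (\<lambda>x. \<Sum>j\<in>J. complex_of_real (c j) * complex_of_real (bump j x)) t" by simp
  also have "\<dots> = (\<Sum>j\<in>J. complex_of_real (c j) * complex_of_real (bump_hat j t))"
    using integrable_bump by (subst fourier_sum) (auto simp: fourier_cmult fourier_bump)
  finally show ?thesis by simp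
qed

lemma fourier_perturbed:
  "fourier (\<lambda>x. complex_of_real (perturbed a T x)) t =
    fourier (\<lambda>x. complex_of_real (base_density x)) t + complex_of_real (\<Sum>j\<in>T. a * bump_hat j t)"
proof -
  have "fourier (\<lambda>x. complex_of_real (perturbed a T x)) t =
    fourier (\<lambda>x. complex_of_real (base_density x) + complex_of_real (\<Sum>j\<in>T. a * bump j x)) t"
    by (simp add: perturbed_def sum_distrib_left)
  also have "\<dots> = fourier (\<lambda>x. complex_of_real (base_density x)) t + complex_of_real (\<Sum>j\<in>T. a * bump_hat j t)"
    unfolding fourier_sum_bump[symmetric]
    by (intro fourier_add complex_of_real_integrable_eq[THEN iffD2] integrable_base_density
        Bochner_Integration.integrable_sum integrable_mult_right integrable_bump)
  finally show ?thesis .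
qed

text \<open>Excluding frequency 0 keeps every bump spectrum away from the origin, so the
  perturbations have integral 0. The bound 1/4 keeps at least half of the base density: each bump is
  dominated by the Fejer kernel, which is at most twice the base density.\<close>

locale bump_family =
  fixes J :: "nat set" and a :: real
  assumes finite_J: "finite J" and zero_notin_J: "0 \<notin> J"
    and a_nonneg: "0 \<le> a" and a_card_le: "a * real (card J) \<le> 1 / 4"
begin

lemma perturbed_bounds:
  assumes T: "T \<subseteq> J"
  shows "base_density x / 2 \<le> perturbed a T x" "perturbed a T x \<le> 2"
proof -
  have "\<bar>\<Sum>j\<in>T. bump j x\<bar> \<le> (\<Sum>j\<in>T. fejer x)"
    by (rule order_trans[OF sum_abs]) (intro sum_mono abs_bump_le)
  also have "\<dots> \<le> real (card J) * fejer x"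
    using card_mono[OF finite_J T] fejer_nonneg[of x] by (simp add: mult_right_mono)
  finally have "a * \<bar>\<Sum>j\<in>T. bump j x\<bar> \<le> a * real (card J) * fejer x"
    using a_nonneg by (simp add: mult_left_mono mult.assoc)
  also have "\<dots> \<le> 1 / 4 * fejer x" by (rule mult_right_mono[OF a_card_le fejer_nonneg])
  also have "\<dots> \<le> base_density x / 2" using fejer_le_base_density[of x] by simp
  finally have "\<bar>a * (\<Sum>j\<in>T. bump j x)\<bar> \<le> base_density x / 2"
    using a_nonneg by (simp add: abs_mult)
  then show "base_density x / 2 \<le> perturbed a T x" "perturbed a T x \<le> 2"
    using base_density_le_1[of x] unfolding perturbed_def by linarith+
qed

lemma perturbed_nonneg: "T \<subseteq> J \<Longrightarrow> 0 \<le> perturbed a T x"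
  using perturbed_bounds(1)[of T x] base_density_nonneg[of x] by simp

lemma prob_density_perturbed:
  assumes T: "T \<subseteq> J"
  shows "prob_density (perturbed a T)"
proof -
  have "bump_hat j 0 = 0" if "j \<in> T" for j
  proof -
    have "j \<noteq> 0" using that T zero_notin_J by (metis subsetD)
    then show ?thesis by (intro bump_hat_eq_0) simp
  qed
  then have "fourier (\<lambda>x. complex_of_real (perturbed a T x)) 0 = 1"
    unfolding fourier_perturbed fourier_base_density_0 by simp
  then have "(LINT x|lborel. perturbed a T x) = 1"
    by (simp add: fourier_def)
  then have "emeasure (density lborel (perturbed a T)) (space (density lborel (perturbed a T))) = 1"
    using perturbed_nonneg[OF T] integrable_perturbed
    by (simp add: emeasure_density nn_integral_eq_integral)
  then show ?thesis
    unfolding prob_density_def using perturbed_nonneg[OF T] by (auto intro: prob_spaceI)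
qed

text \<open>The inequality (x + y)^2 \<le> 2 x^2 + 2 y^2 separates base and perturbation. The base
  spectrum lies in [-1, 1], where the weight is at most 2, and contributes at most 8; the bumps have
  disjoint spectra, and \<open>small\<close> limits their total to 1. Hence the threshold 9.\<close>

lemma perturbed_in_density_class:
  assumes T: "T \<subseteq> J" and N: "\<And>j. j \<in> J \<Longrightarrow> j \<le> N" and \<alpha>: "0 \<le> \<alpha>" and K: "9 \<le> K"
    and small: "8 * a\<^sup>2 * real (card J) * (1 + (2 * real N + 1) powr (2 * \<alpha>)) \<le> 1"
  shows "perturbed a T \<in> density_class \<alpha> K"
proof -
  define w where "w t = 1 + \<bar>t\<bar> powr (2 * \<alpha>)" for t :: real
  define C where "C = 4 * (1 + (2 * real N + 1) powr (2 * \<alpha>))"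
  have [measurable]: "w \<in> borel_measurable borel" unfolding w_def[abs_def] by measurable
  have w0: "0 \<le> w t" for t by (simp add: w_def add_nonneg_nonneg)
  have C0: "0 \<le> C" by (simp add: C_def)
  have fT: "finite T" using T finite_J by (rule finite_subset)
  have base: "(\<integral>\<^sup>+t. ennreal (2 * (tent t)\<^sup>2 * w t) \<partial>lborel) \<le> ennreal 8"
  proof -
    have "(\<integral>\<^sup>+t. ennreal (2 * (tent t)\<^sup>2 * w t) \<partial>lborel) \<le> (\<integral>\<^sup>+t. ennreal 4 * indicator {-1..1::real} t \<partial>lborel)"
    proof (intro nn_integral_mono)
      fix t :: real
      show "ennreal (2 * (tent t)\<^sup>2 * w t) \<le> ennreal 4 * indicator {-1..1} t"
      proof (cases "\<bar>t\<bar> \<le> 1")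
        case True
        then have "w t \<le> 2" using \<alpha> unfolding w_def by (simp add: powr_le1)
        moreover have "(tent t)\<^sup>2 \<le> 1" using tent_nonneg[of t] tent_le_1[of t] by (simp add: power_le_one)
        ultimately have "(tent t)\<^sup>2 * w t \<le> 1 * 2" using w0 by (intro mult_mono) auto
        then have "2 * (tent t)\<^sup>2 * w t \<le> 4" by (simp only: mult.assoc)
        then show ?thesis using True by (simp add: abs_le_iff ennreal_leI del: ennreal_numeral)
      qed (simp add: tent_eq_0)
    qed
    also have "\<dots> = ennreal 8" by (subst nn_integral_cmult) (auto simp flip: ennreal_mult)
    finally show ?thesis .
  qed
  have "(\<integral>\<^sup>+t. ennreal ((norm (char_fun (perturbed a T) t))\<^sup>2 * w t) \<partial>lborel)
     \<le> (\<integral>\<^sup>+t. ennreal (2 * (tent t)\<^sup>2 * w t) + (\<Sum>j\<in>T. ennreal (2 * a\<^sup>2) * ennreal ((bump_hat j t)\<^sup>2 * w t)) \<partial>lborel)"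
  proof (intro nn_integral_mono)
    fix t :: real
    define S where "S = (\<Sum>j\<in>T. a * bump_hat j t)"
    have "norm (char_fun (perturbed a T) t) \<le> tent t + \<bar>S\<bar>"
      unfolding char_fun_eq_fourier fourier_perturbed S_def[symmetric]
      by (rule order_trans[OF norm_triangle_ineq]) (simp add: norm_fourier_base_density)
    then have "(norm (char_fun (perturbed a T) t))\<^sup>2 \<le> (tent t + \<bar>S\<bar>)\<^sup>2"
      by (rule power_mono) simp
    also have "\<dots> \<le> 2 * (tent t)\<^sup>2 + 2 * S\<^sup>2"
      using sum_squares_bound[of "tent t" "\<bar>S\<bar>"] by (simp add: power2_sum)
    also have "S\<^sup>2 = (\<Sum>j\<in>T. a\<^sup>2 * (bump_hat j t)\<^sup>2)"
      unfolding S_def by (rule sum_bump_hat_square[OF fT])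
    finally have "(norm (char_fun (perturbed a T) t))\<^sup>2 * w t \<le> (2 * (tent t)\<^sup>2 + 2 * (\<Sum>j\<in>T. a\<^sup>2 * (bump_hat j t)\<^sup>2)) * w t"
      using w0 by (rule mult_right_mono)
    also have "\<dots> = 2 * (tent t)\<^sup>2 * w t + (\<Sum>j\<in>T. 2 * a\<^sup>2 * ((bump_hat j t)\<^sup>2 * w t))"
      by (simp add: distrib_right sum_distrib_left sum_distrib_right mult.assoc)
    finally have "ennreal ((norm (char_fun (perturbed a T) t))\<^sup>2 * w t)
       \<le> ennreal (2 * (tent t)\<^sup>2 * w t + (\<Sum>j\<in>T. 2 * a\<^sup>2 * ((bump_hat j t)\<^sup>2 * w t)))" by (rule ennreal_leI)
    also have "\<dots> = ennreal (2 * (tent t)\<^sup>2 * w t) + (\<Sum>j\<in>T. ennreal (2 * a\<^sup>2) * ennreal ((bump_hat j t)\<^sup>2 * w t))"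
      using w0[of t] by (simp add: ennreal_plus sum_nonneg flip: ennreal_mult)
    finally show "ennreal ((norm (char_fun (perturbed a T) t))\<^sup>2 * w t)
       \<le> ennreal (2 * (tent t)\<^sup>2 * w t) + (\<Sum>j\<in>T. ennreal (2 * a\<^sup>2) * ennreal ((bump_hat j t)\<^sup>2 * w t))" .
  qed
  also have "\<dots> = (\<integral>\<^sup>+t. ennreal (2 * (tent t)\<^sup>2 * w t) \<partial>lborel)
      + (\<Sum>j\<in>T. ennreal (2 * a\<^sup>2) * (\<integral>\<^sup>+t. ennreal ((bump_hat j t)\<^sup>2 * w t) \<partial>lborel))"
    by (simp add: nn_integral_add nn_integral_sum nn_integral_cmult)
  also have "\<dots> \<le> ennreal 8 + (\<Sum>j\<in>T. ennreal (2 * a\<^sup>2) * ennreal C)"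
  proof (intro add_mono base sum_mono mult_left_mono)
    fix j assume "j \<in> T"
    then have "j \<le> N" using T N by auto
    from nn_integral_bump_hat_weighted_le[OF this \<alpha>]
    show "(\<integral>\<^sup>+t. ennreal ((bump_hat j t)\<^sup>2 * w t) \<partial>lborel) \<le> ennreal C"
      unfolding w_def C_def .
  qed simp
  also have "\<dots> = ennreal (8 + real (card T) * (2 * a\<^sup>2 * C))"
    using C0 by (subst ennreal_plus) (auto simp: ennreal_of_nat_eq_real_of_nat simp flip: ennreal_mult)
  also have "\<dots> \<le> ennreal K"
  proof (rule ennreal_leI)
    have "real (card T) * (2 * a\<^sup>2 * C) \<le> real (card J) * (2 * a\<^sup>2 * C)"
      using card_mono[OF finite_J T] C0 by (intro mult_right_mono) auto
    also have "\<dots> \<le> 1" using small by (simp add: C_def algebra_simps)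
    finally show "8 + real (card T) * (2 * a\<^sup>2 * C) \<le> K" using K by simp
  qed
  finally show ?thesis
    unfolding density_class_def w_def using prob_density_perturbed[OF T] by simp
qed

text \<open>Plancherel's inequality is read as a lower bound for the L2 norm of the difference. On
  the Fourier side the energies add up over the symmetric difference, each at least a^2 / 16, and
  division by 2 pi gives the constant.\<close>

lemma perturbed_separated:
  assumes T: "T \<subseteq> J" "T' \<subseteq> J"
  shows "ennreal (a\<^sup>2 / (32 * pi) * real (card (sym_diff T T')))
    \<le> (\<integral>\<^sup>+x. ennreal ((perturbed a T x - perturbed a T' x)\<^sup>2) \<partial>lborel)"
proof -
  \<comment> \<open>The coefficient is a, -a or 0 according to which set contains j; after squaring
    only the symmetric difference remains.\<close>
  define c where "c j = a * (of_bool (j \<in> T) - of_bool (j \<in> T'))" for j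
  define D where "D = sym_diff T T'"
  define I where "I = (\<integral>\<^sup>+x. ennreal ((perturbed a T x - perturbed a T' x)\<^sup>2) \<partial>lborel)"
  have D: "D \<subseteq> J" "finite D" using T finite_J finite_subset unfolding D_def by blast+
  have diff: "perturbed a T x - perturbed a T' x = (\<Sum>j\<in>J. c j * bump j x)" for x
  proof -
    have "(\<Sum>j\<in>S. bump j x) = (\<Sum>j\<in>J. of_bool (j \<in> S) * bump j x)" if "S \<subseteq> J" for S
      using that finite_J by (intro sum.mono_neutral_cong_left) auto
    then show ?thesis using T
      by (simp add: perturbed_def c_def sum_distrib_left right_diff_distrib left_diff_distrib sum_subtractf mult.assoc)
  qed
  have c2: "(c j)\<^sup>2 = (if j \<in> D then a\<^sup>2 else 0)" for j
    by (auto simp: c_def D_def)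
  have "ennreal (a\<^sup>2 / 16 * real (card D)) = (\<Sum>j\<in>D. ennreal (a\<^sup>2) * ennreal (1 / 16))"
    by (simp add: ennreal_of_nat_eq_real_of_nat mult_ac flip: ennreal_mult del: ennreal_divide_numeral)
  also have "\<dots> \<le> (\<Sum>j\<in>D. ennreal (a\<^sup>2) * (\<integral>\<^sup>+t. ennreal ((bump_hat j t)\<^sup>2) \<partial>lborel))"
    by (intro sum_mono mult_left_mono nn_integral_bump_hat_square_ge) simp
  also have "\<dots> = (\<integral>\<^sup>+t. (\<Sum>j\<in>D. ennreal (a\<^sup>2) * ennreal ((bump_hat j t)\<^sup>2)) \<partial>lborel)"
    by (simp add: nn_integral_sum nn_integral_cmult)
  also have "\<dots> = (\<integral>\<^sup>+t. ennreal ((\<Sum>j\<in>J. c j * bump_hat j t)\<^sup>2) \<partial>lborel)"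
  proof (intro nn_integral_cong)
    fix t
    have "(\<Sum>j\<in>J. c j * bump_hat j t)\<^sup>2 = (\<Sum>j\<in>D. a\<^sup>2 * (bump_hat j t)\<^sup>2)"
      unfolding sum_bump_hat_square[OF finite_J] c2
      using D finite_J by (intro sum.mono_neutral_cong_right) auto
    then show "(\<Sum>j\<in>D. ennreal (a\<^sup>2) * ennreal ((bump_hat j t)\<^sup>2)) = ennreal ((\<Sum>j\<in>J. c j * bump_hat j t)\<^sup>2)"
      by (simp flip: ennreal_mult)
  qed
  also have "\<dots> = (\<integral>\<^sup>+t. ennreal ((norm (fourier (\<lambda>x. complex_of_real (\<Sum>j\<in>J. c j * bump j x)) t))\<^sup>2) \<partial>lborel)"
    unfolding fourier_sum_bump norm_of_real by simp
  also have "\<dots> \<le> ennreal (2 * pi) * (\<integral>\<^sup>+x. ennreal ((norm (complex_of_real (\<Sum>j\<in>J. c j * bump j x)))\<^sup>2) \<partial>lborel)"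
    by (intro plancherel_le complex_of_real_integrable_eq[THEN iffD2]
        Bochner_Integration.integrable_sum integrable_mult_right integrable_bump)
  also have "\<dots> = ennreal (2 * pi) * I"
    unfolding I_def diff norm_of_real by simp
  finally have *: "ennreal (a\<^sup>2 / 16 * real (card D)) \<le> ennreal (2 * pi) * I" .
  have "ennreal (a\<^sup>2 / (32 * pi) * real (card D)) = ennreal (1 / (2 * pi)) * ennreal (a\<^sup>2 / 16 * real (card D))"
    by (subst ennreal_mult[symmetric]) (auto simp: field_simps)
  also have "\<dots> \<le> ennreal (1 / (2 * pi)) * (ennreal (2 * pi) * I)" by (rule mult_left_mono[OF *]) simp
  also have "\<dots> = I" by (simp add: mult.assoc[symmetric] flip: ennreal_mult)
  finally show ?thesis by (simp add: D_def I_def)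
qed

end

section \<open>Testing and Assouad's lemma\<close>

text \<open>For p = 0 the Bernoulli variable is almost surely \<open>True\<close>, so X = V + Z and
  the law is a convolution.\<close>

lemma obs_law_0_eq:
  assumes f: "prob_density f" and k: "prob_density k"
  shows "obs_law k 0 f = density lborel (\<lambda>x. \<integral>\<^sup>+y. ennreal (f (x - y)) * ennreal (k y) \<partial>lborel)"
proof -
  have [measurable]: "f \<in> borel_measurable borel" "k \<in> borel_measurable borel"
    using f k by (auto simp: prob_density_def)
  interpret F: prob_space "density lborel (\<lambda>x. ennreal (f x))" using f by (simp add: prob_density_def)
  interpret K: prob_space "density lborel (\<lambda>x. ennreal (k x))" using k by (simp add: prob_density_def)
  interpret FK: pair_prob_space "density lborel (\<lambda>x. ennreal (f x))" "density lborel (\<lambda>x. ennreal (k x))" ..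
  have "obs_law k 0 f = convolution (density lborel (\<lambda>x. ennreal (f x))) (density lborel (\<lambda>x. ennreal (k x)))"
  proof (rule measure_eqI)
    fix A assume "A \<in> sets (obs_law k 0 f)"
    then have [measurable]: "A \<in> sets borel" by (simp add: obs_law_def)
    have "emeasure (obs_law k 0 f) A = (\<integral>\<^sup>+x. indicator A x \<partial>obs_law k 0 f)"
      by (simp add: obs_law_def)
    also have "\<dots> = (\<integral>\<^sup>+b. \<integral>\<^sup>+(v, z). indicator A (of_bool b * v + z)
        \<partial>(density lborel f \<Otimes>\<^sub>M density lborel k) \<partial>bernoulli_pmf (1 - 0))"
      unfolding obs_law_def
      by (subst nn_integral_distr)
         (auto simp: FK.P.nn_integral_fst[symmetric] case_prod_beta' intro!: nn_integral_cong)
    also have "\<dots> = (\<integral>\<^sup>+(v, z). indicator A (v + z) \<partial>(density lborel f \<Otimes>\<^sub>M density lborel k))"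
      by simp
    also have "\<dots> = emeasure (convolution (density lborel f) (density lborel k)) A"
      unfolding convolution_def
      by (subst nn_integral_indicator[symmetric], simp, subst nn_integral_distr) (auto simp: case_prod_beta')
    finally show "emeasure (obs_law k 0 f) A = emeasure (convolution (density lborel f) (density lborel k)) A" .
  qed (simp add: obs_law_def)
  also have "\<dots> = density lborel (\<lambda>x. \<integral>\<^sup>+y. ennreal (f (x - y)) * ennreal (k y) \<partial>lborel)"
    by (rule convolution_density) (auto intro: F.finite_measure_axioms K.finite_measure_axioms)
  finally show ?thesis .
qed

text \<open>Boxes determine a product measure, and on a box both the density and the indicator
  factorise over the coordinates.\<close>

lemma PiM_density:
  fixes L :: "'a \<Rightarrow> real"
  assumes I: "finite I" and P: "prob_space P" and L0: "\<And>x. 0 \<le> L x"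
    and [measurable]: "L \<in> borel_measurable P" and Q: "prob_space (density P L)"
  shows "(\<Pi>\<^sub>M i\<in>I. density P L) = density (\<Pi>\<^sub>M i\<in>I. P) (\<lambda>x. ennreal (\<Prod>i\<in>I. L (x i)))"
proof -
  interpret P: prob_space P by fact
  interpret Q: prob_space "density P L" by fact
  interpret PP: product_sigma_finite "\<lambda>_::'b. P" ..
  interpret QQ: product_sigma_finite "\<lambda>_::'b. density P L" ..
  show ?thesis
  proof (rule QQ.PiM_eqI[symmetric, OF I])
    show "sets (density (\<Pi>\<^sub>M i\<in>I. P) (\<lambda>x. ennreal (\<Prod>i\<in>I. L (x i)))) = sets (\<Pi>\<^sub>M i\<in>I. density P L)"
      by (simp cong: sets_PiM_cong)
    fix A assume A: "\<And>i. i \<in> I \<Longrightarrow> A i \<in> sets (density P L)"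
    then have [measurable]: "\<And>i. i \<in> I \<Longrightarrow> A i \<in> sets P" by simp
    have "emeasure (density (\<Pi>\<^sub>M i\<in>I. P) (\<lambda>x. ennreal (\<Prod>i\<in>I. L (x i)))) (Pi\<^sub>E I A)
      = (\<integral>\<^sup>+x. ennreal (\<Prod>i\<in>I. L (x i)) * indicator (Pi\<^sub>E I A) x \<partial>(\<Pi>\<^sub>M i\<in>I. P))"
      using I A by (intro emeasure_density) (auto intro!: sets_PiM_I_finite)
    also have "\<dots> = (\<integral>\<^sup>+x. (\<Prod>i\<in>I. ennreal (L (x i)) * indicator (A i) (x i)) \<partial>(\<Pi>\<^sub>M i\<in>I. P))"
    proof (intro nn_integral_cong)
      fix x assume "x \<in> space (\<Pi>\<^sub>M i\<in>I. P)"
      then have "x \<in> extensional I" by (auto simp: space_PiM PiE_def)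
      then have "indicator (Pi\<^sub>E I A) x = (\<Prod>i\<in>I. indicator (A i) (x i) :: ennreal)"
        using I by (auto simp: indicator_def PiE_iff prod_zero_iff)
      then show "ennreal (\<Prod>i\<in>I. L (x i)) * indicator (Pi\<^sub>E I A) x = (\<Prod>i\<in>I. ennreal (L (x i)) * indicator (A i) (x i))"
        by (simp add: prod.distrib prod_ennreal L0)
    qed
    also have "\<dots> = (\<Prod>i\<in>I. \<integral>\<^sup>+x. ennreal (L x) * indicator (A i) x \<partial>P)"
      using I by (intro PP.product_nn_integral_prod) auto
    also have "\<dots> = (\<Prod>i\<in>I. emeasure (density P L) (A i))"
      by (intro prod.cong refl) (simp add: emeasure_density)
    finally show "emeasure (density (\<Pi>\<^sub>M i\<in>I. P) (\<lambda>x. ennreal (\<Prod>i\<in>I. L (x i)))) (Pi\<^sub>E I A)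
      = (\<Prod>i\<in>I. emeasure (density P L) (A i))" .
  qed
qed

text \<open>Integrate the pointwise inequality \<open>\<Lambda> \<le> 1\<^sub>E + \<Lambda> 1\<^sub>E\<^sub>c + \<Lambda>\<^sup>2 / 4\<close> for the likelihood ratio
  \<open>\<Lambda>\<close> of the two product measures; the second moment of \<open>\<Lambda>\<close> tensorises.\<close>

lemma product_testing_lower_bound:
  fixes L :: "'a \<Rightarrow> real"
  assumes I: "finite I" and P: "prob_space P" and L0: "\<And>x. 0 \<le> L x"
    and L [measurable]: "L \<in> borel_measurable P" and Q: "prob_space (density P L)"
    and chi: "(\<integral>\<^sup>+x. ennreal ((L x)\<^sup>2) \<partial>P) \<le> ennreal (1 + \<eta>)"
    and \<eta>: "0 \<le> \<eta>" "real (card I) * \<eta> \<le> 1"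
    and E [measurable]: "E \<in> sets (\<Pi>\<^sub>M i\<in>I. P)"
  shows "ennreal (1 / 4) \<le> emeasure (\<Pi>\<^sub>M i\<in>I. P) E
    + emeasure (\<Pi>\<^sub>M i\<in>I. density P L) (space (\<Pi>\<^sub>M i\<in>I. P) - E)"
proof -
  interpret P: prob_space P by fact
  interpret Q: prob_space "density P L" by fact
  interpret PP: product_sigma_finite "\<lambda>_::'b. P" ..
  define M where "M = (\<Pi>\<^sub>M i\<in>I. P)"
  define Ln where "Ln x = (\<Prod>i\<in>I. L (x i))" for x
  have Ln0: "0 \<le> Ln x" for x unfolding Ln_def by (intro prod_nonneg) (simp add: L0)
  have [measurable]: "Ln \<in> borel_measurable M" unfolding Ln_def[abs_def] M_def by measurable
  have [measurable]: "E \<in> sets M" unfolding M_def by (rule E)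
  have dens: "(\<Pi>\<^sub>M i\<in>I. density P L) = density M Ln"
    unfolding M_def Ln_def[abs_def] by (rule PiM_density[OF I P L0 L Q])
  have total: "(\<integral>\<^sup>+x. ennreal (Ln x) \<partial>M) = 1"
    using prob_space.emeasure_space_1[OF prob_space_PiM[of I "\<lambda>_. density P L", OF Q]]
    unfolding dens by (simp add: emeasure_density)
  \<comment> \<open>The bound (1 + \<eta>)^n \<le> exp (n \<eta>) \<le> e \<le> 3 makes the
    quadratic term at most 3/4, and 1 - 3/4 is the constant of the lemma.\<close>
  have sq: "(\<integral>\<^sup>+x. ennreal ((Ln x)\<^sup>2) \<partial>M) \<le> ennreal 3"
  proof -
    have "(\<integral>\<^sup>+x. ennreal ((Ln x)\<^sup>2) \<partial>M) = (\<integral>\<^sup>+x. (\<Prod>i\<in>I. ennreal ((L (x i))\<^sup>2)) \<partial>M)"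
      by (simp add: Ln_def prod_ennreal prod_power_distrib[symmetric])
    also have "\<dots> = (\<Prod>i\<in>I. \<integral>\<^sup>+x. ennreal ((L x)\<^sup>2) \<partial>P)"
      unfolding M_def using I by (intro PP.product_nn_integral_prod) auto
    also have "\<dots> \<le> (\<Prod>i\<in>I. ennreal (1 + \<eta>))" by (intro prod_mono_ennreal chi)
    also have "\<dots> = ennreal ((1 + \<eta>) ^ card I)" using \<eta> by (simp add: ennreal_power del: ennreal_plus)
    also have "\<dots> \<le> ennreal 3"
    proof (rule ennreal_leI)
      have "(1 + \<eta>) ^ card I \<le> exp \<eta> ^ card I" using \<eta>(1) by (intro power_mono exp_ge_add_one_self) auto
      also have "\<dots> = exp (real (card I) * \<eta>)" by (simp add: exp_of_nat_mult)
      also have "\<dots> \<le> exp 1" using \<eta> by simp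
      also have "\<dots> \<le> 3" by (rule exp_le)
      finally show "(1 + \<eta>) ^ card I \<le> 3" .
    qed
    finally show ?thesis .
  qed
  have "1 = (\<integral>\<^sup>+x. ennreal (Ln x) \<partial>M)" by (simp add: total)
  also have "\<dots> \<le> (\<integral>\<^sup>+x. indicator E x + ennreal (Ln x) * indicator (space M - E) x + ennreal (1 / 4) * ennreal ((Ln x)\<^sup>2) \<partial>M)"
  proof (intro nn_integral_mono)
    fix x assume x: "x \<in> space M"
    \<comment> \<open>This gives \<Lambda> \<le> 1 + \<Lambda>^2 / 4, which is used on
      \<open>E\<close>; off \<open>E\<close> the ratio \<Lambda> itself stands on the right.\<close>
    have "0 \<le> (Ln x / 2 - 1)\<^sup>2" by simp
    then have "Ln x \<le> 1 + 1 / 4 * (Ln x)\<^sup>2" by (simp add: power2_eq_square algebra_simps)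
    then have "ennreal (Ln x) \<le> 1 + ennreal (1 / 4) * ennreal ((Ln x)\<^sup>2)"
      by (simp add: ennreal_mult[symmetric] ennreal_1[symmetric] ennreal_plus[symmetric] del: ennreal_1 ennreal_plus ennreal_divide_numeral)
    then show "ennreal (Ln x) \<le> indicator E x + ennreal (Ln x) * indicator (space M - E) x + ennreal (1 / 4) * ennreal ((Ln x)\<^sup>2)"
      using x by (cases "x \<in> E") auto
  qed
  also have "\<dots> = emeasure M E + emeasure (density M Ln) (space M - E) + ennreal (1 / 4) * (\<integral>\<^sup>+x. ennreal ((Ln x)\<^sup>2) \<partial>M)"
    by (simp add: nn_integral_add nn_integral_cmult emeasure_density del: ennreal_divide_numeral)
  also have "\<dots> \<le> emeasure M E + emeasure (density M Ln) (space M - E) + ennreal (1 / 4) * ennreal 3"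
    by (intro add_left_mono mult_left_mono sq) simp
  finally have "ennreal (3 / 4) + ennreal (1 / 4) \<le> ennreal (3 / 4) + (emeasure M E + emeasure (density M Ln) (space M - E))"
    unfolding add.commute[of "ennreal (3 / 4)" "emeasure M E + _"]
    by (simp add: ennreal_mult[symmetric] ennreal_plus[symmetric] del: ennreal_plus ennreal_divide_numeral ennreal_numeral)
  then show ?thesis
    unfolding dens M_def[symmetric] by (subst (asm) ennreal_add_left_cancel_le) (auto simp del: ennreal_divide_numeral)
qed

text \<open>Pairing each set without j with its extension by j reduces an average over the cube to
  two-point tests in direction j.\<close>

lemma sum_Pow_split:
  assumes "finite J" "j \<in> J"
  shows "(\<Sum>T\<in>Pow J. g T) = (\<Sum>T\<in>Pow (J - {j}). g T + g (insert j T))"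
proof -
  have J: "J = insert j (J - {j})" using assms by auto
  have "(\<Sum>T\<in>Pow J. g T) = (\<Sum>T\<in>Pow (J - {j}) \<union> insert j ` Pow (J - {j}). g T)"
    by (subst J, subst Pow_insert) simp
  also have "\<dots> = (\<Sum>T\<in>Pow (J - {j}). g T) + (\<Sum>T\<in>insert j ` Pow (J - {j}). g T)"
    using assms by (intro sum.union_disjoint) auto
  also have "(\<Sum>T\<in>insert j ` Pow (J - {j}). g T) = (\<Sum>T\<in>Pow (J - {j}). g (insert j T))"
    by (subst sum.reindex) (auto simp: inj_on_def)
  finally show ?thesis by (simp add: sum.distrib)
qed

text \<open>Assouad's lemma: replace the decision by the hypothesis \<open>\<theta>\<close> of least loss and bound its
  expected Hamming distance to the truth one coordinate at a time.\<close>

lemma assouad: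
  fixes M :: "'a set \<Rightarrow> 'b measure" and D :: "'a set \<Rightarrow> 'b \<Rightarrow> ennreal"
  assumes J: "finite J"
    and sets_M: "\<And>T. T \<subseteq> J \<Longrightarrow> sets (M T) = sets N"
    and D: "\<And>T. T \<subseteq> J \<Longrightarrow> D T \<in> borel_measurable N"
    and sep: "\<And>T T' \<omega>. T \<subseteq> J \<Longrightarrow> T' \<subseteq> J \<Longrightarrow> \<omega> \<in> space N \<Longrightarrow> s * of_nat (card (sym_diff T T')) \<le> D T \<omega> + D T' \<omega>"
    and test: "\<And>j T E. j \<in> J \<Longrightarrow> T \<subseteq> J - {j} \<Longrightarrow> E \<in> sets N \<Longrightarrow>
      c \<le> emeasure (M T) E + emeasure (M (insert j T)) (space N - E)"
  shows "2 ^ card J * (of_nat (card J) * (s * c)) \<le> 4 * (\<Sum>T\<in>Pow J. \<integral>\<^sup>+\<omega>. D T \<omega> \<partial>M T)"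
proof -
  \<comment> \<open>Numbering the hypotheses lets ties be broken by the least index, which makes the
    selected hypothesis measurable.\<close>
  obtain e :: "nat \<Rightarrow> 'a set" where e: "bij_betw e {..<card (Pow J)} (Pow J)"
    using ex_bij_betw_nat_finite[of "Pow J"] J by (auto simp: atLeast0LessThan)
  define m where "m = card (Pow J)"
  have e_in: "e i \<subseteq> J" if "i < m" for i
    using e that bij_betwE[OF e] unfolding m_def by auto
  have e_onto: "\<exists>i<m. e i = T" if "T \<subseteq> J" for T
    using e that unfolding m_def bij_betw_def by (metis PowI imageE lessThan_iff)
  define best where "best i \<omega> \<longleftrightarrow> i < m \<and> (\<forall>l<m. D (e i) \<omega> \<le> D (e l) \<omega>)" for i \<omega>
  define idx where "idx \<omega> = (LEAST i. best i \<omega>)" for \<omega>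
  define \<theta> where "\<theta> \<omega> = e (idx \<omega>)" for \<omega>
  have ex: "\<exists>i. best i \<omega>" for \<omega>
  proof -
    have ne: "finite ((\<lambda>i. D (e i) \<omega>) ` {..<m})" "(\<lambda>i. D (e i) \<omega>) ` {..<m} \<noteq> {}"
      using J by (auto simp: m_def card_Pow lessThan_empty_iff)
    from Min_in[OF ne] obtain i where "i < m" "D (e i) \<omega> = Min ((\<lambda>i. D (e i) \<omega>) ` {..<m})" by auto
    then show ?thesis using Min_le[OF ne(1)] by (auto simp: best_def)
  qed
  have best: "best (idx \<omega>) \<omega>" for \<omega> unfolding idx_def using ex by (rule LeastI_ex)
  have \<theta>_J: "\<theta> \<omega> \<subseteq> J" for \<omega> using best e_in by (auto simp: best_def \<theta>_def)
  have \<theta>_min: "D (\<theta> \<omega>) \<omega> \<le> D T \<omega>" if T: "T \<subseteq> J" for T \<omega>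
    using best[of \<omega>] e_onto[OF T] by (auto simp: best_def \<theta>_def)
  have best_meas: "Measurable.pred N (best i)" for i
  proof (cases "i < m")
    case True
    have "(\<lambda>\<omega>. D (e i) \<omega> \<le> D (e l) \<omega>) \<in> measurable N (count_space UNIV)" if "l < m" for l
    proof -
      have [measurable]: "D (e i) \<in> borel_measurable N" "D (e l) \<in> borel_measurable N"
        using D e_in True that by auto
      show ?thesis by measurable
    qed
    then have "(\<lambda>\<omega>. \<forall>l\<in>{..<m}. D (e i) \<omega> \<le> D (e l) \<omega>) \<in> measurable N (count_space UNIV)"
      by (intro pred_intros_finite) auto
    moreover have "best i = (\<lambda>\<omega>. \<forall>l\<in>{..<m}. D (e i) \<omega> \<le> D (e l) \<omega>)"
      using True by (auto simp: best_def)
    ultimately show ?thesis by simp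
  qed (simp add: best_def[abs_def])
  have idx_meas: "idx \<in> measurable N (count_space UNIV)"
    unfolding idx_def[abs_def] using best_meas by (rule measurable_Least)
  define E where "E j = {\<omega> \<in> space N. j \<in> \<theta> \<omega>}" for j
  have E: "E j \<in> sets N" for j
  proof -
    have "E j = idx -` {i. j \<in> e i} \<inter> space N" by (auto simp: E_def \<theta>_def)
    then show ?thesis using idx_meas by (auto intro: measurable_sets)
  qed
  have space_M: "space (M T) = space N" if "T \<subseteq> J" for T using sets_M[OF that] by (rule sets_eq_imp_space_eq)
  \<comment> \<open>\<open>F j T\<close> is the event that the selected set errs in coordinate j
    when \<open>T\<close> is the truth. Summing its indicators over j gives the Hamming
    distance.\<close>
  define F where "F j T = (if j \<in> T then space N - E j else E j)" for j T
  have F: "F j T \<in> sets (M T)" if "T \<subseteq> J" for j T using E sets_M[OF that] by (auto simp: F_def)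
  have loss: "s * (\<Sum>j\<in>J. emeasure (M T) (F j T)) \<le> 2 * (\<integral>\<^sup>+\<omega>. D T \<omega> \<partial>M T)" if T: "T \<subseteq> J" for T
  proof -
    have "s * (\<Sum>j\<in>J. emeasure (M T) (F j T)) = (\<integral>\<^sup>+\<omega>. s * (\<Sum>j\<in>J. indicator (F j T) \<omega>) \<partial>M T)"
      using F[OF T] by (simp add: nn_integral_cmult nn_integral_sum)
    also have "\<dots> \<le> (\<integral>\<^sup>+\<omega>. 2 * D T \<omega> \<partial>M T)"
    proof (intro nn_integral_mono)
      fix \<omega> assume "\<omega> \<in> space (M T)"
      then have \<omega>: "\<omega> \<in> space N" using space_M[OF T] by simp
      have "(\<Sum>j\<in>J. indicator (F j T) \<omega>) = (\<Sum>j\<in>J. indicator (sym_diff T (\<theta> \<omega>)) j :: ennreal)"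
        using \<omega> by (intro sum.cong refl) (auto simp: F_def E_def indicator_def)
      also have "\<dots> = of_nat (card (J \<inter> sym_diff T (\<theta> \<omega>)))"
        using J sum.inter_restrict[OF J, of "\<lambda>_. 1 :: ennreal" "sym_diff T (\<theta> \<omega>)"]
        by (simp only: indicator_def of_bool_def) simp
      also have "J \<inter> sym_diff T (\<theta> \<omega>) = sym_diff T (\<theta> \<omega>)" using T \<theta>_J by blast
      \<comment> \<open>Separation bounds the Hamming loss by two losses, and by minimality the loss
        of the selected set is at most that of \<open>T\<close>. This is the factor 2.\<close>
      finally have "s * (\<Sum>j\<in>J. indicator (F j T) \<omega>) \<le> D T \<omega> + D (\<theta> \<omega>) \<omega>"
        using sep[OF T \<theta>_J \<omega>] by simp
      also have "\<dots> \<le> D T \<omega> + D T \<omega>" by (intro add_left_mono \<theta>_min T)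
      finally show "s * (\<Sum>j\<in>J. indicator (F j T) \<omega>) \<le> 2 * D T \<omega>" by (simp add: mult_2)
    qed
    also have "\<dots> = 2 * (\<integral>\<^sup>+\<omega>. D T \<omega> \<partial>M T)"
      using D[OF T] measurable_cong_sets[OF sets_M[OF T] refl] by (intro nn_integral_cmult) auto
    finally show ?thesis .
  qed
  \<comment> \<open>The cube splits into 2^(|J| - 1) pairs that differ only in j, and on each pair
    the two errors are the two errors of one test.\<close>
  have coord: "2 ^ card J * c \<le> 2 * (\<Sum>T\<in>Pow J. emeasure (M T) (F j T))" if j: "j \<in> J" for j
  proof -
    have "2 ^ card J * c = 2 * (\<Sum>T\<in>Pow (J - {j}). c)"
    proof -
      have "card J = Suc (card (J - {j}))" using J j by (rule card.remove)
      then show ?thesis using J by (simp only: power_Suc sum_constant card_Pow finite_Diff of_nat_power of_nat_numeral mult.assoc)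
    qed
    also have "\<dots> \<le> 2 * (\<Sum>T\<in>Pow (J - {j}). emeasure (M T) (F j T) + emeasure (M (insert j T)) (F j (insert j T)))"
    proof (intro mult_left_mono sum_mono)
      fix T assume "T \<in> Pow (J - {j})"
      then have "T \<subseteq> J - {j}" by simp
      from test[OF j this E] show "c \<le> emeasure (M T) (F j T) + emeasure (M (insert j T)) (F j (insert j T))"
        using \<open>T \<subseteq> J - {j}\<close> by (auto simp: F_def)
    qed simp
    also have "\<dots> = 2 * (\<Sum>T\<in>Pow J. emeasure (M T) (F j T))"
      by (subst sum_Pow_split[OF J j]) simp
    finally show ?thesis .
  qed
  have "2 ^ card J * (of_nat (card J) * (s * c)) = s * (\<Sum>j\<in>J. 2 ^ card J * c)"
    by (simp add: ac_simps)
  also have "\<dots> \<le> s * (\<Sum>j\<in>J. 2 * (\<Sum>T\<in>Pow J. emeasure (M T) (F j T)))"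
    by (intro mult_left_mono sum_mono coord) auto
  also have "\<dots> = 2 * (\<Sum>T\<in>Pow J. s * (\<Sum>j\<in>J. emeasure (M T) (F j T)))"
    by (simp add: sum_distrib_left ac_simps) (rule sum.swap)
  also have "\<dots> \<le> 2 * (\<Sum>T\<in>Pow J. 2 * (\<integral>\<^sup>+\<omega>. D T \<omega> \<partial>M T))"
    by (intro mult_left_mono sum_mono loss) auto
  also have "\<dots> = 4 * (\<Sum>T\<in>Pow J. \<integral>\<^sup>+\<omega>. D T \<omega> \<partial>M T)"
    by (simp add: sum_distrib_left[symmetric] mult.assoc[symmetric])
  finally show ?thesis .
qed

section \<open>Blurring by the noise\<close>

text \<open>The convolution of \<open>f\<close> and \<open>k\<close>. It is a real-valued integral
  because it is also applied to bumps, which change sign.\<close>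

definition blur :: "(real \<Rightarrow> real) \<Rightarrow> (real \<Rightarrow> real) \<Rightarrow> real \<Rightarrow> real" where
  "blur k f x = (LINT y|lborel. f (x - y) * k y)"

lemma prob_density_measurable [measurable_dest]: "prob_density k \<Longrightarrow> k \<in> borel_measurable borel"
  and prob_density_nonneg: "prob_density k \<Longrightarrow> 0 \<le> k x"
  by (simp_all add: prob_density_def)

lemma prob_density_nn_integral:
  assumes "prob_density k"
  shows "(\<integral>\<^sup>+x. ennreal (k x) \<partial>lborel) = 1"
  using prob_space.emeasure_space_1[of "density lborel k"] assms
  by (simp add: prob_density_def emeasure_density)

lemma prob_density_integrable:
  assumes "prob_density k"
  shows "integrable lborel k" "(LINT x|lborel. k x) = 1"
proof -
  have [measurable]: "k \<in> borel_measurable borel" using assms by measurable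
  show "integrable lborel k"
    by (rule integrableI_nn_integral_finite[of _ _ 1])
       (auto simp: prob_density_nonneg[OF assms] prob_density_nn_integral[OF assms])
  show "(LINT x|lborel. k x) = 1"
    by (rule integral_eq_nn_integral[THEN trans])
       (auto simp: prob_density_nonneg[OF assms] prob_density_nn_integral[OF assms])
qed

lemma integrable_blur:
  assumes k: "prob_density k" and [measurable]: "f \<in> borel_measurable borel" and f: "\<And>x. \<bar>f x\<bar> \<le> C"
  shows "integrable lborel (\<lambda>y. f (x - y) * k y)"
proof (rule Bochner_Integration.integrable_bound)
  have [measurable]: "k \<in> borel_measurable borel" using k by measurable
  show "integrable lborel (\<lambda>y. C * k y)" using prob_density_integrable(1)[OF k] by simp
  show "AE y in lborel. norm (f (x - y) * k y) \<le> norm (C * k y)"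
  proof (rule AE_I2)
    fix y
    have "\<bar>f (x - y)\<bar> \<le> \<bar>C\<bar>" using f[of "x - y"] by linarith
    then show "norm (f (x - y) * k y) \<le> norm (C * k y)" by (simp add: abs_mult mult_right_mono)
  qed
qed (use k in measurable)

lemma borel_measurable_blur [measurable]:
  assumes [measurable]: "k \<in> borel_measurable borel" "f \<in> borel_measurable borel"
  shows "blur k f \<in> borel_measurable borel"
  unfolding blur_def[abs_def] by measurable

text \<open>A bounded \<open>f\<close> makes the convolution finite at every point, so its extended
  nonnegative integral agrees with the real one.\<close>

lemma obs_law_0_blur:
  assumes f: "prob_density f" and k: "prob_density k" and le: "\<And>x. f x \<le> C"
  shows "obs_law k 0 f = density lborel (\<lambda>x. ennreal (blur k f x))"
proof -
  have "(\<integral>\<^sup>+y. ennreal (f (x - y)) * ennreal (k y) \<partial>lborel) = ennreal (blur k f x)" for x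
  proof -
    have "integrable lborel (\<lambda>y. f (x - y) * k y)"
      using le prob_density_nonneg[OF f] by (intro integrable_blur[OF k, of _ C]) (auto intro: prob_density_measurable[OF f])
    then show ?thesis unfolding blur_def
      using prob_density_nonneg[OF f] prob_density_nonneg[OF k]
      by (subst nn_integral_eq_integral[symmetric]) (auto simp: ennreal_mult)
  qed
  then show ?thesis by (simp add: obs_law_0_eq[OF f k])
qed

lemma fourier_bump_hat:
  assumes "y \<noteq> 0"
  shows "fourier (\<lambda>t. complex_of_real (bump_hat j t)) y = complex_of_real (2 * pi * bump j y)"
proof -
  have int: "integrable lborel (\<lambda>t. 1 / 2 * complex_of_real (tent (t - s)))" for s
    using lborel_integrable_real_affine[OF integrable_tent, of 1 "- s"] by simp
  have "(\<lambda>t. complex_of_real (bump_hat j t)) = (\<lambda>t. 1 / 2 * complex_of_real (tent (t - 2 * real j))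
      + 1 / 2 * complex_of_real (tent (t - - (2 * real j))))"
    by (simp add: bump_hat_def add_divide_distrib)
  then have "fourier (\<lambda>t. complex_of_real (bump_hat j t)) y
     = 1 / 2 * (iexp (y * (2 * real j)) * complex_of_real (2 * pi * fejer y))
      + 1 / 2 * (iexp (y * - (2 * real j)) * complex_of_real (2 * pi * fejer y))"
    unfolding fourier_tent[OF assms, symmetric] fourier_shift[of "\<lambda>t. complex_of_real (tent t)", symmetric]
    by (simp only: fourier_add[OF int int] fourier_cmult)
  also have "\<dots> = complex_of_real (2 * pi) * complex_of_real (bump j y)"
    unfolding complex_bump_eq by (simp add: algebra_simps)
  finally show ?thesis by simp
qed

lemma bump_minus: "bump j (- x) = bump j x"
  by (simp add: bump_def fejer_def)

lemma integrable_bump_hat: "integrable lborel (bump_hat j)"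
proof -
  have "integrable lborel (\<lambda>t. tent (t - s))" for s
    using lborel_integrable_real_affine[OF integrable_tent, of 1 "- s"] by simp
  from this[of "2 * real j"] this[of "- (2 * real j)"] show ?thesis
    unfolding bump_hat_def[abs_def] by simp
qed

lemma borel_measurable_char_fun [measurable]:
  assumes [measurable]: "k \<in> borel_measurable borel"
  shows "char_fun k \<in> borel_measurable borel"
  unfolding char_fun_eq_fourier by measurable

lemma integrable_bump_hat_char_fun:
  assumes k: "prob_density k"
  shows "integrable lborel (\<lambda>t. complex_of_real (bump_hat j t) * char_fun k t)"
proof (rule Bochner_Integration.integrable_bound[OF integrable_bump_hat])
  have [measurable]: "k \<in> borel_measurable borel" using k by measurable
  show "(\<lambda>t. complex_of_real (bump_hat j t) * char_fun k t) \<in> borel_measurable lborel" by measurable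
  have "norm (char_fun k t) \<le> 1" for t
    unfolding char_fun_eq_fourier using prob_density_nonneg[OF k] prob_density_integrable(2)[OF k]
    by (intro order_trans[OF norm_fourier_le]) simp
  then show "AE t in lborel. norm (complex_of_real (bump_hat j t) * char_fun k t) \<le> norm (bump_hat j t)"
    by (simp add: norm_mult mult_left_le)
qed

text \<open>Up to the factor 2 pi a bump is itself the transform of \<open>bump_hat\<close>, so the
  multiplication formula moves the transform onto \<open>k\<close>. This is Fourier inversion for
  the convolution, whose spectrum is the product of the two spectra.\<close>

lemma blur_bump_eq:
  assumes k: "prob_density k"
  shows "complex_of_real (blur k (bump j) x)
    = fourier (\<lambda>t. complex_of_real (bump_hat j t) * char_fun k t) (- x) / complex_of_real (2 * pi)"
proof -
  have [measurable]: "k \<in> borel_measurable borel" using k by measurable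
  define u where "u = (\<lambda>t. iexp (- x * t) * complex_of_real (bump_hat j t))"
  have u: "integrable lborel u"
    unfolding u_def by (intro integrable_iexp_mult complex_of_real_integrable_eq[THEN iffD2] integrable_bump_hat)
  have um [measurable]: "u \<in> borel_measurable borel" unfolding u_def by measurable
  have "complex_of_real (blur k (bump j) x) = (CLINT y|lborel. complex_of_real (bump j (x - y) * k y))"
    unfolding blur_def by (rule integral_complex_of_real[symmetric])
  also have "\<dots> = (CLINT y|lborel. fourier u y * complex_of_real (k y) / complex_of_real (2 * pi))"
  proof (rule integral_cong_AE)
    \<comment> \<open>The point y = x is discarded: there the bump is evaluated at 0, where division
      gives the conventional value 0.\<close>
    show "AE y in lborel. complex_of_real (bump j (x - y) * k y) = fourier u y * complex_of_real (k y) / complex_of_real (2 * pi)"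
      using AE_lborel_singleton[of x]
    proof eventually_elim
      case (elim y)
      then have "fourier u y = complex_of_real (2 * pi * bump j (y + - x))"
        unfolding u_def fourier_modulate by (intro fourier_bump_hat) simp
      then show ?case using bump_minus[of j "x - y"] by simp
    qed
  qed measurable
  also have "\<dots> = (CLINT y|lborel. fourier u y * complex_of_real (k y)) / complex_of_real (2 * pi)"
    by (rule integral_divide_zero)
  also have "(CLINT y|lborel. fourier u y * complex_of_real (k y)) = (CLINT t|lborel. u t * fourier (\<lambda>y. complex_of_real (k y)) t)"
    using prob_density_integrable(1)[OF k] by (intro fourier_multiplication u) simp
  also have "\<dots> = fourier (\<lambda>t. complex_of_real (bump_hat j t) * char_fun k t) (- x)"
    unfolding u_def char_fun_eq_fourier[symmetric] fourier_def[of "\<lambda>t. complex_of_real (bump_hat j t) * char_fun k t"]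
    by (simp only: mult.assoc)
  finally show ?thesis .
qed

lemma norm_diff_le_vector_derivative:
  fixes f :: "real \<Rightarrow> complex"
  assumes "0 < d" and "\<And>s. t \<le> s \<Longrightarrow> s \<le> t + d \<Longrightarrow> f differentiable (at s) \<and> norm (vector_derivative f (at s)) \<le> B"
  shows "norm (f (t + d) - f t) \<le> d * B"
proof -
  have der: "(f has_vector_derivative vector_derivative f (at s)) (at s)" if "t \<le> s" "s \<le> t + d" for s
    using assms(2)[OF that] by (simp add: vector_derivative_works)
  have "continuous_on {t..t + d} f"
    using der by (intro continuous_at_imp_continuous_on ballI has_vector_derivative_continuous) auto
  then obtain s where s: "s \<in> {t<..<t + d}" "norm (f (t + d) - f t) \<le> norm ((t + d - t) *\<^sub>R vector_derivative f (at s))"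
    using mvt_general[of t "t + d" f "\<lambda>s h. h *\<^sub>R vector_derivative f (at s)"] der assms(1)
    unfolding has_vector_derivative_def by auto
  then have "norm (f (t + d) - f t) \<le> d * norm (vector_derivative f (at s))" using assms(1) by simp
  also have "\<dots> \<le> d * B" using assms s(1) by (intro mult_left_mono) auto
  finally show ?thesis .
qed

text \<open>Multiplication by \<open>x\<close> becomes differentiation on the Fourier side, which is where the
  hypothesis on the derivative of the noise characteristic function enters.\<close>

lemma blur_bump_weighted_le:
  assumes k: "prob_density k" and \<epsilon>: "0 \<le> \<epsilon>"
    and noise: "\<And>t. 2 * real j - 2 \<le> \<bar>t\<bar> \<Longrightarrow> norm (char_fun k t) \<le> \<epsilon> \<and>
      char_fun k differentiable (at t) \<and> norm (vector_derivative (char_fun k) (at t)) \<le> \<epsilon>"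
  shows "(\<integral>\<^sup>+x. ennreal ((1 + x\<^sup>2) * (blur k (bump j) x)\<^sup>2) \<partial>lborel) \<le> ennreal (6 * \<epsilon>\<^sup>2)"
proof -
  define u where "u = (\<lambda>t. complex_of_real (bump_hat j t) * char_fun k t)"
  have [measurable]: "k \<in> borel_measurable borel" using k by measurable
  have u: "integrable lborel u" unfolding u_def by (rule integrable_bump_hat_char_fun[OF k])
  have um [measurable]: "u \<in> borel_measurable borel" unfolding u_def by measurable
  have u_le: "norm (u t) \<le> \<epsilon>" for t
  proof (cases "1 \<le> \<bar>\<bar>t\<bar> - 2 * real j\<bar>")
    case True
    then show ?thesis using \<epsilon> by (simp add: u_def bump_hat_eq_0)
  next
    case False
    then have "norm (char_fun k t) \<le> \<epsilon>" using noise[of t] by linarith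
    then have "bump_hat j t * norm (char_fun k t) \<le> 1 * \<epsilon>"
      using bump_hat_le_1[of j t] bump_hat_nonneg[of j t] by (intro mult_mono) auto
    then show ?thesis using bump_hat_nonneg[of j t] by (simp add: u_def norm_mult)
  qed
  \<comment> \<open>A discrete product rule: one \<epsilon> comes from the Lipschitz constant 1 of
    \<open>bump_hat\<close>, the other from the derivative of the noise transform.\<close>
  have u_diff: "norm (u (t + d) - u t) \<le> d * (2 * \<epsilon>)" if d: "0 < d" "d \<le> 1" for t d
  proof (cases "1 \<le> \<bar>\<bar>t\<bar> - 2 * real j\<bar> \<and> 1 \<le> \<bar>\<bar>t + d\<bar> - 2 * real j\<bar>")
    case True
    then show ?thesis using \<epsilon> d by (simp add: u_def bump_hat_eq_0)
  next
    case False
    \<comment> \<open>One end of the segment is within 1 of +-2j and its length is at most 1. This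
      explains the range beyond 2j - 2 in the assumption on the noise.\<close>
    have seg: "2 * real j - 2 \<le> \<bar>s\<bar>" if "t \<le> s" "s \<le> t + d" for s
      using False that d by linarith
    have "u (t + d) - u t = complex_of_real (bump_hat j (t + d) - bump_hat j t) * char_fun k (t + d)
        + complex_of_real (bump_hat j t) * (char_fun k (t + d) - char_fun k t)"
      by (simp add: u_def algebra_simps)
    also have "norm \<dots> \<le> \<bar>bump_hat j (t + d) - bump_hat j t\<bar> * norm (char_fun k (t + d))
        + bump_hat j t * norm (char_fun k (t + d) - char_fun k t)"
      using bump_hat_nonneg[of j t]
      by (intro order_trans[OF norm_triangle_ineq]) (simp only: norm_mult norm_of_real abs_of_nonneg order_refl)
    also have "\<dots> \<le> d * \<epsilon> + 1 * (d * \<epsilon>)"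
    proof (intro add_mono mult_mono)
      show "\<bar>bump_hat j (t + d) - bump_hat j t\<bar> \<le> d" using bump_hat_diff_le[of j "t + d" t] d by simp
      show "norm (char_fun k (t + d)) \<le> \<epsilon>" using noise[OF seg[of "t + d"]] d by simp
      show "norm (char_fun k (t + d) - char_fun k t) \<le> d * \<epsilon>"
        using noise seg by (intro norm_diff_le_vector_derivative d(1)) blast
    qed (use d \<epsilon> bump_hat_le_1 in auto)
    finally show ?thesis by (simp add: algebra_simps)
  qed
  have near: "(\<integral>\<^sup>+t. ennreal ((norm (v t))\<^sup>2) \<partial>lborel) \<le> ennreal (B\<^sup>2 * (4 * r))"
    if "\<And>t. norm (v t) \<le> B" "\<And>t. r < \<bar>\<bar>t\<bar> - 2 * real j\<bar> \<Longrightarrow> v t = 0" "0 \<le> r" for v :: "real \<Rightarrow> complex" and B r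
  proof -
    have "(\<integral>\<^sup>+t. ennreal ((norm (v t))\<^sup>2) \<partial>lborel)
        \<le> (\<integral>\<^sup>+t. ennreal (B\<^sup>2) * indicator {t. \<bar>\<bar>t\<bar> - 2 * real j\<bar> \<le> r} t \<partial>lborel)"
    proof (intro nn_integral_mono)
      fix t
      show "ennreal ((norm (v t))\<^sup>2) \<le> ennreal (B\<^sup>2) * indicator {t. \<bar>\<bar>t\<bar> - 2 * real j\<bar> \<le> r} t"
        using that(1)[of t] that(2)[of t] by (auto split: split_indicator intro!: ennreal_leI power_mono simp: not_le)
    qed
    also have "\<dots> = ennreal (B\<^sup>2) * (\<integral>\<^sup>+t. indicator {t. \<bar>\<bar>t\<bar> - 2 * real j\<bar> \<le> r} t \<partial>lborel)"
      by (rule nn_integral_cmult) measurable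
    also have "\<dots> \<le> ennreal (B\<^sup>2) * ennreal (4 * r)"
      by (intro mult_left_mono nn_integral_near_frequency_le that(3)) simp
    finally show ?thesis using that(3) by (simp add: ennreal_mult)
  qed
  have p0: "(\<integral>\<^sup>+x. ennreal ((norm (fourier u x))\<^sup>2) \<partial>lborel) \<le> ennreal (2 * pi * (4 * \<epsilon>\<^sup>2))"
  proof -
    have "(\<integral>\<^sup>+t. ennreal ((norm (u t))\<^sup>2) \<partial>lborel) \<le> ennreal (\<epsilon>\<^sup>2 * (4 * 1))"
      by (rule near[OF u_le]) (auto simp: u_def bump_hat_eq_0)
    then have "ennreal (2 * pi) * (\<integral>\<^sup>+t. ennreal ((norm (u t))\<^sup>2) \<partial>lborel) \<le> ennreal (2 * pi) * ennreal (4 * \<epsilon>\<^sup>2)"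
      by (intro mult_left_mono) (auto simp: mult.commute)
    also have "\<dots> = ennreal (2 * pi * (4 * \<epsilon>\<^sup>2))" by (rule ennreal_mult[symmetric]) auto
    finally show ?thesis by (rule order_trans[OF plancherel_le[OF u]])
  qed
  \<comment> \<open>The increments of \<open>u\<close> live within distance 2 of the frequencies
    +-2j, a set of length at most 8, and are at most 2 d \<epsilon>; hence the constant 4 * 8 =
    32.\<close>
  have p1: "(\<integral>\<^sup>+x. ennreal (x\<^sup>2 * (norm (fourier u x))\<^sup>2) \<partial>lborel) \<le> ennreal (2 * pi * (32 * \<epsilon>\<^sup>2))"
  proof (rule plancherel_derivative_le[OF u])
    fix d :: real assume d: "0 < d" "d \<le> 1"
    have "(\<integral>\<^sup>+t. ennreal ((norm (u (t + d) - u t))\<^sup>2) \<partial>lborel) \<le> ennreal ((d * (2 * \<epsilon>))\<^sup>2 * (4 * 2))"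
    proof (rule near)
      fix t :: real assume "2 < \<bar>\<bar>t\<bar> - 2 * real j\<bar>"
      then have "1 \<le> \<bar>\<bar>t\<bar> - 2 * real j\<bar>" "1 \<le> \<bar>\<bar>t + d\<bar> - 2 * real j\<bar>" using d by linarith+
      then show "u (t + d) - u t = 0" by (simp add: u_def bump_hat_eq_0)
    qed (use u_diff d in auto)
    then show "(\<integral>\<^sup>+t. ennreal ((norm (u (t + d) - u t))\<^sup>2) \<partial>lborel) \<le> ennreal (d\<^sup>2 * (32 * \<epsilon>\<^sup>2))"
      by (simp add: power_mult_distrib mult_ac)
  qed simp
  have blur: "(blur k (bump j) x)\<^sup>2 = (norm (fourier u (- x)))\<^sup>2 / (2 * pi)\<^sup>2" for x
  proof -
    have "\<bar>blur k (bump j) x\<bar> = norm (complex_of_real (blur k (bump j) x))" by simp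
    also have "\<dots> = norm (fourier u (- x)) / (2 * pi)"
      unfolding blur_bump_eq[OF k] u_def[symmetric] norm_divide norm_of_real by simp
    finally have "\<bar>blur k (bump j) x\<bar>\<^sup>2 = (norm (fourier u (- x)) / (2 * pi))\<^sup>2" by simp
    then show ?thesis by (simp only: power2_abs power_divide)
  qed
  have "(\<integral>\<^sup>+x. ennreal ((1 + x\<^sup>2) * (blur k (bump j) x)\<^sup>2) \<partial>lborel)
     = (\<integral>\<^sup>+x. ennreal (1 / (2 * pi)\<^sup>2) * (ennreal ((norm (fourier u (- x)))\<^sup>2) + ennreal ((- x)\<^sup>2 * (norm (fourier u (- x)))\<^sup>2)) \<partial>lborel)"
    unfolding blur
    by (intro nn_integral_cong, subst ennreal_plus[symmetric], simp, simp, subst ennreal_mult[symmetric])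
       (auto simp: field_simps)
  also have "\<dots> = (\<integral>\<^sup>+x. ennreal (1 / (2 * pi)\<^sup>2) * (ennreal ((norm (fourier u x))\<^sup>2) + ennreal (x\<^sup>2 * (norm (fourier u x))\<^sup>2)) \<partial>lborel)"
    by (subst (2) nn_integral_real_affine[where c="-1" and t=0]) auto
  also have "\<dots> = ennreal (1 / (2 * pi)\<^sup>2) * ((\<integral>\<^sup>+x. ennreal ((norm (fourier u x))\<^sup>2) \<partial>lborel)
      + (\<integral>\<^sup>+x. ennreal (x\<^sup>2 * (norm (fourier u x))\<^sup>2) \<partial>lborel))"
    by (subst nn_integral_cmult) (auto simp: nn_integral_add)
  also have "\<dots> \<le> ennreal (1 / (2 * pi)\<^sup>2) * (ennreal (2 * pi * (4 * \<epsilon>\<^sup>2)) + ennreal (2 * pi * (32 * \<epsilon>\<^sup>2)))"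
    by (intro mult_left_mono add_mono p0 p1) simp
  also have "\<dots> = ennreal (1 / (2 * pi)\<^sup>2 * (2 * pi * (4 * \<epsilon>\<^sup>2) + 2 * pi * (32 * \<epsilon>\<^sup>2)))"
    by (subst ennreal_plus[symmetric], simp, simp, subst ennreal_mult[symmetric]) auto
  \<comment> \<open>The constants 4 and 32 add up to 36, and 36 / (2 pi) = 18 / pi is at most 6
    because pi > 3.\<close>
  also have "1 / (2 * pi)\<^sup>2 * (2 * pi * (4 * \<epsilon>\<^sup>2) + 2 * pi * (32 * \<epsilon>\<^sup>2)) = 18 / pi * \<epsilon>\<^sup>2"
    by (simp add: power2_eq_square field_simps)
  also have "ennreal (18 / pi * \<epsilon>\<^sup>2) \<le> ennreal (6 * \<epsilon>\<^sup>2)"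
    using pi_gt3 by (intro ennreal_leI mult_right_mono) (auto simp: field_simps)
  finally show ?thesis .
qed

section \<open>Chi-square distance and a tail bound for blurred densities\<close>

lemma ennreal_divide_le_of_le_mult:
  assumes "0 < c" "ennreal x \<le> ennreal c * y"
  shows "ennreal (x / c) \<le> y"
proof -
  have "ennreal (x / c) = ennreal (1 / c) * ennreal x"
    using assms(1) by (cases "0 \<le> x") (auto simp: ennreal_neg divide_nonpos_pos simp flip: ennreal_mult)
  also have "\<dots> \<le> ennreal (1 / c) * (ennreal c * y)" by (intro mult_left_mono assms(2)) simp
  also have "\<dots> = y" using assms(1) by (simp add: mult.assoc[symmetric] flip: ennreal_mult)
  finally show ?thesis .
qed

text \<open>Pointwise, p + p (q / p)^2 = 2 q + (q - p)^2 / p. Keeping \<open>p\<close> on the left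
  avoids truncated subtraction in \<open>ennreal\<close>, and the identity remains valid when both
  sides are infinite.\<close>

lemma second_moment_likelihood_ratio:
  fixes p q :: "real \<Rightarrow> real"
  assumes [measurable]: "p \<in> borel_measurable borel" "q \<in> borel_measurable borel"
    and p0: "\<And>x. 0 < p x" and q0: "\<And>x. 0 \<le> q x"
    and p1: "(\<integral>\<^sup>+x. ennreal (p x) \<partial>lborel) = 1" and q1: "(\<integral>\<^sup>+x. ennreal (q x) \<partial>lborel) = 1"
  shows "(\<integral>\<^sup>+x. ennreal ((q x / p x)\<^sup>2) \<partial>density lborel (\<lambda>x. ennreal (p x)))
    = 1 + (\<integral>\<^sup>+x. ennreal ((q x - p x)\<^sup>2 / p x) \<partial>lborel)"
proof -
  define X where "X = (\<integral>\<^sup>+x. ennreal ((q x / p x)\<^sup>2) \<partial>density lborel (\<lambda>x. ennreal (p x)))"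
  define Y where "Y = (\<integral>\<^sup>+x. ennreal ((q x - p x)\<^sup>2 / p x) \<partial>lborel)"
  have X: "X = (\<integral>\<^sup>+x. ennreal (p x) * ennreal ((q x / p x)\<^sup>2) \<partial>lborel)"
    unfolding X_def by (subst nn_integral_density) auto
  have "1 + X = (\<integral>\<^sup>+x. ennreal (p x) + ennreal (p x) * ennreal ((q x / p x)\<^sup>2) \<partial>lborel)"
    unfolding X p1[symmetric] by (rule nn_integral_add[symmetric]) auto
  also have "\<dots> = (\<integral>\<^sup>+x. (ennreal (q x) + ennreal (q x)) + ennreal ((q x - p x)\<^sup>2 / p x) \<partial>lborel)"
  proof (intro nn_integral_cong)
    fix x
    have "ennreal (p x) + ennreal (p x) * ennreal ((q x / p x)\<^sup>2) = ennreal (p x + p x * (q x / p x)\<^sup>2)"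
      using p0[of x] by (simp add: ennreal_mult ennreal_plus)
    also have "p x + p x * (q x / p x)\<^sup>2 = (q x + q x) + (q x - p x)\<^sup>2 / p x"
      using p0[of x] by (simp add: field_simps power2_eq_square)
    also have "ennreal \<dots> = (ennreal (q x) + ennreal (q x)) + ennreal ((q x - p x)\<^sup>2 / p x)"
      using p0[of x] q0[of x] ennreal_plus[of "q x + q x" "(q x - p x)\<^sup>2 / p x"] ennreal_plus[of "q x" "q x"]
      by simp
    finally show "ennreal (p x) + ennreal (p x) * ennreal ((q x / p x)\<^sup>2)
      = (ennreal (q x) + ennreal (q x)) + ennreal ((q x - p x)\<^sup>2 / p x)" .
  qed
  also have "\<dots> = 1 + (1 + Y)"
    unfolding Y_def by (simp add: nn_integral_add q1 add.assoc)
  finally have "X = 1 + Y" by (subst (asm) ennreal_add_left_cancel) auto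
  then show ?thesis by (simp add: X_def Y_def)
qed

lemma blur_perturbed_insert:
  assumes k: "prob_density k" and T: "finite T" "j \<notin> T"
  shows "blur k (perturbed a (insert j T)) x - blur k (perturbed a T) x = a * blur k (bump j) x"
proof -
  have bump: "integrable lborel (\<lambda>y. bump i (x - y) * k y)" for i
    by (rule integrable_blur[OF k, of _ 1]) (use abs_bump_le fejer_le_1 order_trans in \<open>auto, blast\<close>)
  have base: "integrable lborel (\<lambda>y. base_density (x - y) * k y)"
    by (rule integrable_blur[OF k, of _ 1]) (use base_density_nonneg base_density_le_1 in auto)
  have per: "integrable lborel (\<lambda>y. perturbed a S (x - y) * k y)" for S
  proof -
    have "(\<lambda>y. perturbed a S (x - y) * k y) = (\<lambda>y. base_density (x - y) * k y + a * (\<Sum>i\<in>S. bump i (x - y) * k y))"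
      by (simp add: perturbed_def distrib_right sum_distrib_right mult.assoc)
    then show ?thesis using bump base by simp
  qed
  have "blur k (perturbed a (insert j T)) x - blur k (perturbed a T) x
    = (LINT y|lborel. perturbed a (insert j T) (x - y) * k y - perturbed a T (x - y) * k y)"
    unfolding blur_def by (rule Bochner_Integration.integral_diff[OF per per, symmetric])
  also have "\<dots> = (LINT y|lborel. a * (bump j (x - y) * k y))"
    using T by (intro Bochner_Integration.integral_cong refl) (simp add: perturbed_def algebra_simps)
  finally show ?thesis by (simp add: blur_def)
qed

text \<open>The factor (1 - cos (1/2)) / (2 pi) comes from \<open>base_density_ge\<close>. The
  further 1/4 pays for halving the base density and for separating x from y in 1 + (x - y)^2. The
  integral is finite and positive for every noise density, however heavy its tails, and the constant
  depends on the noise alone.\<close>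

definition tail_constant :: "(real \<Rightarrow> real) \<Rightarrow> real" where
  "tail_constant k = (1 - cos (1 / 2)) / (8 * pi) * (LINT y|lborel. k y / (1 + y\<^sup>2))"

lemma integrable_tail:
  assumes k: "prob_density k"
  shows "integrable lborel (\<lambda>y. k y / (1 + y\<^sup>2))"
proof (rule Bochner_Integration.integrable_bound[OF prob_density_integrable(1)[OF k]])
  have [measurable]: "k \<in> borel_measurable borel" using k by measurable
  show "(\<lambda>y. k y / (1 + y\<^sup>2)) \<in> borel_measurable lborel" by measurable
  show "AE y in lborel. norm (k y / (1 + y\<^sup>2)) \<le> norm (k y)"
  proof (rule AE_I2)
    fix y :: real
    have "\<bar>k y\<bar> / (1 + y\<^sup>2) \<le> \<bar>k y\<bar> / 1" by (rule divide_left_mono) (auto simp: add_pos_nonneg)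
    then show "norm (k y / (1 + y\<^sup>2)) \<le> norm (k y)" by (simp add: abs_divide)
  qed
qed

lemma tail_constant_pos:
  assumes k: "prob_density k"
  shows "0 < tail_constant k"
proof -
  have pos: "1 + y\<^sup>2 > 0" for y :: real by (simp add: add_pos_nonneg)
  have nn: "0 \<le> k y / (1 + y\<^sup>2)" for y
    using prob_density_nonneg[OF k] pos[of y] by simp
  have "(LINT y|lborel. k y / (1 + y\<^sup>2)) \<noteq> 0"
  proof
    assume "(LINT y|lborel. k y / (1 + y\<^sup>2)) = 0"
    then have "AE y in lborel. k y / (1 + y\<^sup>2) = 0"
      using integral_nonneg_eq_0_iff_AE[OF integrable_tail[OF k]] nn by simp
    then have "AE y in lborel. k y = 0" using pos by (simp add: less_imp_neq[symmetric])
    then have "(LINT y|lborel. k y) = 0" by (rule integral_eq_zero_AE)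
    then show False using prob_density_integrable(2)[OF k] by simp
  qed
  moreover have "0 \<le> (LINT y|lborel. k y / (1 + y\<^sup>2))" by (rule integral_nonneg_AE) (simp add: nn)
  ultimately show ?thesis unfolding tail_constant_def using cos_half_less_1 by simp
qed

section \<open>The risk bound for a bump family\<close>

context bump_family
begin

lemma blur_perturbed_ge:
  assumes k: "prob_density k" and T: "T \<subseteq> J"
  shows "tail_constant k / (1 + x\<^sup>2) \<le> blur k (perturbed a T) x"
proof -
  define c where "c = (1 - cos (1 / 2 :: real)) / (2 * pi)"
  have c0: "0 \<le> c" using cos_half_less_1 by (simp add: c_def)
  have pos: "1 + y\<^sup>2 > 0" for y :: real by (simp add: add_pos_nonneg)
  have "tail_constant k / (1 + x\<^sup>2) = (LINT y|lborel. c / 4 / (1 + x\<^sup>2) * (k y / (1 + y\<^sup>2)))"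
    unfolding tail_constant_def c_def integral_mult_right_zero by simp
  also have "\<dots> \<le> blur k (perturbed a T) x"
    unfolding blur_def
  proof (rule integral_mono)
    show "integrable lborel (\<lambda>y. c / 4 / (1 + x\<^sup>2) * (k y / (1 + y\<^sup>2)))"
      using integrable_tail[OF k] by (rule integrable_mult_right)
    show "integrable lborel (\<lambda>y. perturbed a T (x - y) * k y)"
      using perturbed_bounds(2)[OF T] perturbed_nonneg[OF T] by (intro integrable_blur[OF k, of _ 2]) auto
    fix y :: real
    have eq: "c / 4 / X * (z / Y) = c / (2 * (X * Y)) / 2 * z" for X Y z :: real by simp
    \<comment> \<open>An inequality of Peetre type: 1 + (x - y)^2 is dominated by a product of
      separate weights, so the factor in x leaves the integral.\<close>
    have "2 * ((1 + x\<^sup>2) * (1 + y\<^sup>2)) - (1 + (x - y)\<^sup>2) = 1 + (x + y)\<^sup>2 + 2 * (x * y)\<^sup>2"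
      by (simp add: power2_eq_square algebra_simps)
    then have "1 + (x - y)\<^sup>2 \<le> 2 * ((1 + x\<^sup>2) * (1 + y\<^sup>2))"
      using zero_le_power2[of "x + y"] zero_le_power2[of "x * y"] by linarith
    then have "c / (2 * ((1 + x\<^sup>2) * (1 + y\<^sup>2))) \<le> c / (1 + (x - y)\<^sup>2)"
      using pos by (intro divide_left_mono c0 mult_pos_pos) auto
    also have "\<dots> \<le> base_density (x - y)" unfolding c_def by (rule base_density_ge)
    also have "\<dots> \<le> 2 * perturbed a T (x - y)" using perturbed_bounds(1)[OF T, of "x - y"] by simp
    finally have "c / (2 * ((1 + x\<^sup>2) * (1 + y\<^sup>2))) / 2 \<le> perturbed a T (x - y)"
      unfolding pos_divide_le_eq[OF zero_less_numeral] by (simp only: mult.commute)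
    then have "c / (2 * ((1 + x\<^sup>2) * (1 + y\<^sup>2))) / 2 * k y \<le> perturbed a T (x - y) * k y"
      using prob_density_nonneg[OF k] by (rule mult_right_mono)
    then show "c / 4 / (1 + x\<^sup>2) * (k y / (1 + y\<^sup>2)) \<le> perturbed a T (x - y) * k y"
      by (simp only: eq)
  qed
  finally show ?thesis .
qed

text \<open>The supremum dominates the average risk over the cube of perturbations at p = 0, to
  which Assouad's lemma applies with integrated squared error as loss. \<open>small\<close> puts the
  cube into the class, and the last assumption says that n times the chi-square bound is at most 1.
  The constant 1024 is 64 from separation, 4 from testing and 4 from Assouad's lemma.\<close>

lemma minimax_risk_ge:
  assumes k: "prob_density k" and p: "0 \<le> pstar" and \<alpha>: "0 \<le> \<alpha>" and K: "9 \<le> K"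
    and N: "\<And>j. j \<in> J \<Longrightarrow> j \<le> N"
    and small: "8 * a\<^sup>2 * real (card J) * (1 + (2 * real N + 1) powr (2 * \<alpha>)) \<le> 1"
    and \<epsilon>: "0 \<le> \<epsilon>"
    and noise: "\<And>j t. j \<in> J \<Longrightarrow> 2 * real j - 2 \<le> \<bar>t\<bar> \<Longrightarrow> norm (char_fun k t) \<le> \<epsilon> \<and>
      char_fun k differentiable (at t) \<and> norm (vector_derivative (char_fun k) (at t)) \<le> \<epsilon>"
    and n: "real n * (6 / tail_constant k * a\<^sup>2 * \<epsilon>\<^sup>2) \<le> 1"
  shows "ennreal (a\<^sup>2 * real (card J) / (1024 * pi)) \<le> minimax_risk k \<alpha> K pstar n"
  unfolding minimax_risk_def
proof (rule INF_greatest)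
  fix g assume "g \<in> estimators n"
  then have g [measurable]: "case_prod g \<in> borel_measurable ((\<Pi>\<^sub>M i\<in>{1..n}. borel) \<Otimes>\<^sub>M borel)"
    by (simp add: estimators_def)
  have [measurable]: "k \<in> borel_measurable borel" using k by measurable
  define P where "P T = blur k (perturbed a T)" for T
  have [measurable]: "P T \<in> borel_measurable borel" for T unfolding P_def by measurable
  define \<kappa> where "\<kappa> = tail_constant k"
  have \<kappa>: "0 < \<kappa>" unfolding \<kappa>_def by (rule tail_constant_pos[OF k])
  have pos: "1 + x\<^sup>2 > 0" for x :: real by (simp add: add_pos_nonneg)
  have P_ge: "\<kappa> / (1 + x\<^sup>2) \<le> P T x" if "T \<subseteq> J" for T x
    unfolding \<kappa>_def P_def by (rule blur_perturbed_ge[OF k that])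
  have P_pos: "0 < P T x" if "T \<subseteq> J" for T x
    using P_ge[OF that, of x] \<kappa> pos[of x] by (meson divide_pos_pos less_le_trans)
  have law: "obs_law k 0 (perturbed a T) = density lborel (\<lambda>x. ennreal (P T x))" if "T \<subseteq> J" for T
    unfolding P_def
    using perturbed_bounds(2)[OF that] by (intro obs_law_0_blur[OF prob_density_perturbed[OF that] k])
  \<comment> \<open>Total mass 1 is read off from the law as the image of a product of probability
    spaces.\<close>
  have prob: "prob_space (density lborel (\<lambda>x. ennreal (P T x)))" if "T \<subseteq> J" for T
  proof -
    interpret F: prob_space "density lborel (perturbed a T)"
      using prob_density_perturbed[OF that] by (simp add: prob_density_def)
    interpret K: prob_space "density lborel k" using k by (simp add: prob_density_def)
    interpret FK: pair_prob_space "density lborel (perturbed a T)" "density lborel k" ..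
    interpret B: pair_prob_space "measure_pmf (bernoulli_pmf (1 - 0))" "density lborel (perturbed a T) \<Otimes>\<^sub>M density lborel k" ..
    show ?thesis unfolding law[OF that, symmetric] obs_law_def
      by (rule B.prob_space_distr) measurable
  qed
  have P1: "(\<integral>\<^sup>+x. ennreal (P T x) \<partial>lborel) = 1" if "T \<subseteq> J" for T
    using prob_space.emeasure_space_1[OF prob[OF that]] by (simp add: emeasure_density)
  define N0 where "N0 = (\<Pi>\<^sub>M i\<in>{1..n}. (borel :: real measure))"
  define M where "M T = sample_law k n 0 (perturbed a T)" for T
  define D where "D T xs = (\<integral>\<^sup>+x. ennreal ((g xs x - perturbed a T x)\<^sup>2) \<partial>lborel)" for T xs
  have M_eq: "M T = (\<Pi>\<^sub>M i\<in>{1..n}. density lborel (\<lambda>x. ennreal (P T x)))" if "T \<subseteq> J" for T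
    unfolding M_def sample_law_def law[OF that] ..
  have sets_M: "sets (M T) = sets N0" if "T \<subseteq> J" for T
    unfolding M_eq[OF that] N0_def by (intro sets_PiM_cong) auto
  have "2 ^ card J * (of_nat (card J) * (ennreal (a\<^sup>2 / (64 * pi)) * ennreal (1 / 4)))
     \<le> 4 * (\<Sum>T\<in>Pow J. \<integral>\<^sup>+xs. D T xs \<partial>M T)"
  proof (rule assouad[OF finite_J, of M N0 D])
    fix T assume "T \<subseteq> J"
    then show "sets (M T) = sets N0" by (rule sets_M)
    show "D T \<in> borel_measurable N0" unfolding D_def[abs_def] N0_def by measurable
  next
    fix T T' xs assume T: "T \<subseteq> J" "T' \<subseteq> J" and xs: "xs \<in> space N0"
    have [measurable]: "g xs \<in> borel_measurable borel"
      using measurable_Pair2[OF g, of xs] xs by (simp add: N0_def)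
    have "ennreal (a\<^sup>2 / (32 * pi) * real (card (sym_diff T T')))
      \<le> (\<integral>\<^sup>+x. ennreal ((perturbed a T x - perturbed a T' x)\<^sup>2) \<partial>lborel)"
      by (rule perturbed_separated[OF T])
    also have "\<dots> \<le> (\<integral>\<^sup>+x. 2 * ennreal ((g xs x - perturbed a T x)\<^sup>2) + 2 * ennreal ((g xs x - perturbed a T' x)\<^sup>2) \<partial>lborel)"
    proof (intro nn_integral_mono)
      fix x
      define u v where "u = g xs x - perturbed a T x" and "v = g xs x - perturbed a T' x"
      \<comment> \<open>The parallelogram identity replaces the triangle inequality for the squared
        distance; its factor 2 turns 32 into 64.\<close>
      have "2 * u\<^sup>2 + 2 * v\<^sup>2 - (v - u)\<^sup>2 = (u + v)\<^sup>2"
        by (simp add: power2_eq_square algebra_simps)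
      then have "(v - u)\<^sup>2 \<le> 2 * u\<^sup>2 + 2 * v\<^sup>2" using zero_le_power2[of "u + v"] by linarith
      then have "ennreal ((v - u)\<^sup>2) \<le> ennreal (2 * u\<^sup>2 + 2 * v\<^sup>2)" by (rule ennreal_leI)
      also have "\<dots> = 2 * ennreal (u\<^sup>2) + 2 * ennreal (v\<^sup>2)" by (simp add: ennreal_plus ennreal_mult)
      finally show "ennreal ((perturbed a T x - perturbed a T' x)\<^sup>2) \<le> 2 * ennreal ((g xs x - perturbed a T x)\<^sup>2) + 2 * ennreal ((g xs x - perturbed a T' x)\<^sup>2)"
        by (simp add: u_def v_def)
    qed
    also have "\<dots> = ennreal 2 * (D T xs + D T' xs)"
      by (simp add: D_def nn_integral_add nn_integral_cmult distrib_left)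
    finally have "ennreal (a\<^sup>2 / (32 * pi) * real (card (sym_diff T T')) / 2) \<le> D T xs + D T' xs"
      by (intro ennreal_divide_le_of_le_mult) simp_all
    also have "a\<^sup>2 / (32 * pi) * real (card (sym_diff T T')) / 2 = a\<^sup>2 / (64 * pi) * real (card (sym_diff T T'))"
      by simp
    also have "ennreal \<dots> = ennreal (a\<^sup>2 / (64 * pi)) * of_nat (card (sym_diff T T'))"
      by (simp only: ennreal_of_nat_eq_real_of_nat) (rule ennreal_mult, auto)
    finally show "ennreal (a\<^sup>2 / (64 * pi)) * of_nat (card (sym_diff T T')) \<le> D T xs + D T' xs" .
  next
    fix j T E assume j: "j \<in> J" and T: "T \<subseteq> J - {j}" and E: "E \<in> sets N0"
    define T' where "T' = insert j T"
    have sub: "T \<subseteq> J" "T' \<subseteq> J" "j \<notin> T" "finite T"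
      using T j finite_J finite_subset by (auto simp: T'_def)
    define L where "L x = P T' x / P T x" for x
    define Q where "Q = density lborel (\<lambda>x. ennreal (P T x))"
    define \<eta> where "\<eta> = 6 / \<kappa> * a\<^sup>2 * \<epsilon>\<^sup>2"
    have \<eta>: "0 \<le> \<eta>" using \<kappa> by (simp add: \<eta>_def)
    have L0: "0 \<le> L x" for x using P_pos[OF sub(1), of x] P_pos[OF sub(2), of x] by (simp add: L_def)
    have L_meas [measurable]: "L \<in> borel_measurable borel" unfolding L_def[abs_def] by measurable
    have L_meas': "L \<in> borel_measurable Q" unfolding Q_def by simp
    have dens: "density Q L = density lborel (\<lambda>x. ennreal (P T' x))"
    proof -
      have "ennreal (P T x) * ennreal (L x) = ennreal (P T' x)" for x
        using P_pos[OF sub(1), of x] P_pos[OF sub(2), of x] L0[of x]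
        by (simp add: ennreal_mult[symmetric] L_def)
      then show ?thesis unfolding Q_def by (subst density_density_eq) auto
    qed
    have "(\<integral>\<^sup>+x. ennreal ((P T' x - P T x)\<^sup>2 / P T x) \<partial>lborel)
       \<le> (\<integral>\<^sup>+x. ennreal (a\<^sup>2 / \<kappa>) * ennreal ((1 + x\<^sup>2) * (blur k (bump j) x)\<^sup>2) \<partial>lborel)"
    proof (intro nn_integral_mono)
      fix x
      \<comment> \<open>Bounding the denominator below by its tail produces the weight 1 + x^2 of
        \<open>blur_bump_weighted_le\<close>.\<close>
      have "(P T' x - P T x)\<^sup>2 / P T x \<le> (P T' x - P T x)\<^sup>2 / (\<kappa> / (1 + x\<^sup>2))"
        using P_ge[OF sub(1)] P_pos[OF sub(1)] \<kappa> pos by (intro divide_left_mono) auto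
      also have "\<dots> = a\<^sup>2 / \<kappa> * ((1 + x\<^sup>2) * (blur k (bump j) x)\<^sup>2)"
        unfolding P_def T'_def blur_perturbed_insert[OF k sub(4,3)] by (simp add: power_mult_distrib)
      finally show "ennreal ((P T' x - P T x)\<^sup>2 / P T x) \<le> ennreal (a\<^sup>2 / \<kappa>) * ennreal ((1 + x\<^sup>2) * (blur k (bump j) x)\<^sup>2)"
        using \<kappa> pos[of x] by (subst ennreal_mult[symmetric]) (auto intro: ennreal_leI)
    qed
    also have "\<dots> = ennreal (a\<^sup>2 / \<kappa>) * (\<integral>\<^sup>+x. ennreal ((1 + x\<^sup>2) * (blur k (bump j) x)\<^sup>2) \<partial>lborel)"
      by (rule nn_integral_cmult) measurable
    also have "\<dots> \<le> ennreal (a\<^sup>2 / \<kappa>) * ennreal (6 * \<epsilon>\<^sup>2)"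
      using noise[OF j] by (intro mult_left_mono blur_bump_weighted_le[OF k \<epsilon>]) auto
    also have "\<dots> = ennreal \<eta>"
      using \<kappa> by (subst ennreal_mult[symmetric]) (auto simp: \<eta>_def)
    finally have "(\<integral>\<^sup>+x. ennreal ((L x)\<^sup>2) \<partial>Q) \<le> 1 + ennreal \<eta>"
      unfolding L_def Q_def
      by (subst second_moment_likelihood_ratio)
         (auto intro: P_pos[OF sub(1)] less_imp_le[OF P_pos[OF sub(2)]] simp: P1[OF sub(1)] P1[OF sub(2)])
    then have chi: "(\<integral>\<^sup>+x. ennreal ((L x)\<^sup>2) \<partial>Q) \<le> ennreal (1 + \<eta>)" using \<eta> by simp
    have E': "E \<in> sets (\<Pi>\<^sub>M i\<in>{1..n}. Q)"
      using E sets_M[OF sub(1)] unfolding M_eq[OF sub(1)] Q_def by simp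
    have sp: "space (\<Pi>\<^sub>M i\<in>{1..n}. Q) = space N0" by (simp add: N0_def Q_def space_PiM)
    have "ennreal (1 / 4) \<le> emeasure (\<Pi>\<^sub>M i\<in>{1..n}. Q) E
      + emeasure (\<Pi>\<^sub>M i\<in>{1..n}. density Q L) (space (\<Pi>\<^sub>M i\<in>{1..n}. Q) - E)"
      by (rule product_testing_lower_bound[OF _ _ L0 L_meas' _ chi \<eta> _ E'])
         (use prob[OF sub(1)] prob[OF sub(2)] n in \<open>auto simp: Q_def[symmetric] dens \<eta>_def \<kappa>_def\<close>)
    then show "ennreal (1 / 4) \<le> emeasure (M T) E + emeasure (M (insert j T)) (space N0 - E)"
      unfolding dens sp unfolding Q_def T'_def[symmetric] M_eq[OF sub(1)] M_eq[OF sub(2)] .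
  qed
  also have "(\<Sum>T\<in>Pow J. \<integral>\<^sup>+xs. D T xs \<partial>M T)
     \<le> (\<Sum>T\<in>Pow J. SUP (f, p)\<in>density_class \<alpha> K \<times> {0..pstar}. risk k n g p f)"
  proof (intro sum_mono)
    fix T assume "T \<in> Pow J"
    then have "(perturbed a T, 0) \<in> density_class \<alpha> K \<times> {0..pstar}"
      using perturbed_in_density_class[OF _ N \<alpha> K small] p by auto
    moreover have "(\<integral>\<^sup>+xs. D T xs \<partial>M T) = (case (perturbed a T, 0) of (f, p) \<Rightarrow> risk k n g p f)"
      by (simp add: D_def M_def risk_def)
    ultimately show "(\<integral>\<^sup>+xs. D T xs \<partial>M T) \<le> (SUP (f, p)\<in>density_class \<alpha> K \<times> {0..pstar}. risk k n g p f)"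
      by (metis (no_types, lifting) SUP_upper)
  qed
  also have "(\<Sum>T\<in>Pow J. SUP (f, p)\<in>density_class \<alpha> K \<times> {0..pstar}. risk k n g p f)
     = 2 ^ card J * (SUP (f, p)\<in>density_class \<alpha> K \<times> {0..pstar}. risk k n g p f)"
    using finite_J by (simp add: card_Pow)
  finally have le: "2 ^ card J * (of_nat (card J) * (ennreal (a\<^sup>2 / (64 * pi)) * ennreal (1 / 4)))
     \<le> 2 ^ card J * (4 * (SUP (f, p)\<in>density_class \<alpha> K \<times> {0..pstar}. risk k n g p f))"
    by (simp add: mult_left_mono mult.left_commute)
  show "ennreal (a\<^sup>2 * real (card J) / (1024 * pi)) \<le> (SUP (f, p)\<in>density_class \<alpha> K \<times> {0..pstar}. risk k n g p f)"
  proof -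
    define S where "S = (SUP (f, p)\<in>density_class \<alpha> K \<times> {0..pstar}. risk k n g p f)"
    have "of_nat (card J) * (ennreal (a\<^sup>2 / (64 * pi)) * ennreal (1 / 4)) \<le> ennreal 4 * S"
      using le unfolding S_def[symmetric] by (subst (asm) ennreal_mult_le_mult_iff) (auto simp: power_eq_top_ennreal)
    also have "of_nat (card J) * (ennreal (a\<^sup>2 / (64 * pi)) * ennreal (1 / 4))
       = ennreal (real (card J) * (a\<^sup>2 / (64 * pi) * (1 / 4)))"
      unfolding ennreal_of_nat_eq_real_of_nat
      by (subst ennreal_mult[symmetric], simp, simp, subst ennreal_mult[symmetric]) auto
    finally have "ennreal (real (card J) * (a\<^sup>2 / (64 * pi) * (1 / 4)) / 4) \<le> S"
      by (intro ennreal_divide_le_of_le_mult) simp_all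
    then show ?thesis by (simp add: S_def mult.commute)
  qed
qed

end

section \<open>Lower bounds on the minimax risk\<close>

lemma exists_nat_ceiling:
  assumes "0 < (x::real)"
  obtains m :: nat where "1 \<le> m" "x \<le> real m" "real m \<le> x + 1"
proof
  have "0 < \<lceil>x\<rceil>" using assms by simp
  then show "1 \<le> nat \<lceil>x\<rceil>" "x \<le> real (nat \<lceil>x\<rceil>)" "real (nat \<lceil>x\<rceil>) \<le> x + 1"
    using ceiling_correct[of x] by linarith+
qed

text \<open>A single constant, independent of n, has to meet the positivity, smoothness and testing
  constraints.\<close>

lemma exists_small_amplitude:
  assumes "0 \<le> A" "0 \<le> (B::real)"
  obtains c where "0 < c" "c \<le> 1 / 4" "c\<^sup>2 * A \<le> 1" "c\<^sup>2 * B \<le> 1"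
proof
  define W where "W = 4 + A + B"
  have W: "4 \<le> W" "A \<le> W" "B \<le> W" using assms by (auto simp: W_def)
  show "0 < 1 / W" "1 / W \<le> 1 / 4" using W by (auto simp: field_simps)
  have "(1 / W)\<^sup>2 * x \<le> 1" if "x \<le> W" for x
  proof -
    have "W * 1 \<le> W * W" using W by (intro mult_left_mono) auto
    then have "x \<le> W\<^sup>2" using that by (simp add: power2_eq_square)
    then show ?thesis using W by (simp add: power_divide divide_le_eq_1)
  qed
  then show "(1 / W)\<^sup>2 * A \<le> 1" "(1 / W)\<^sup>2 * B \<le> 1" using W by auto
qed

text \<open>The factor 5 covers both frequency ranges: 4m + 1 and 2m + 3 are at most 5m for m at
  least 1.\<close>

lemma weight_le:
  assumes "1 \<le> (m::nat)" "0 \<le> \<alpha>" "N \<le> 5 * real m" "0 \<le> N"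
  shows "real m powr (- (2 * \<alpha>)) * (1 + N powr (2 * \<alpha>)) \<le> 1 + 5 powr (2 * \<alpha>)"
proof -
  have "N powr (2 * \<alpha>) \<le> (5 * real m) powr (2 * \<alpha>)" using assms by (intro powr_mono2) auto
  then have N: "N powr (2 * \<alpha>) \<le> 5 powr (2 * \<alpha>) * real m powr (2 * \<alpha>)" by (simp add: powr_mult)
  have one: "1 \<le> real m powr (2 * \<alpha>)" using assms by (intro ge_one_powr_ge_zero) auto
  have "real m powr (- (2 * \<alpha>)) * (1 + N powr (2 * \<alpha>))
     \<le> real m powr (- (2 * \<alpha>)) * (real m powr (2 * \<alpha>) + 5 powr (2 * \<alpha>) * real m powr (2 * \<alpha>))"
    using N one by (intro mult_left_mono add_mono) auto
  also have "\<dots> = (real m powr (- (2 * \<alpha>)) * real m powr (2 * \<alpha>)) * (1 + 5 powr (2 * \<alpha>))"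
    by (simp add: algebra_simps)
  also have "real m powr (- (2 * \<alpha>)) * real m powr (2 * \<alpha>) = 1" using assms by (simp flip: powr_add)
  finally show ?thesis by simp
qed

lemma minimax_risk_polynomial:
  assumes k: "prob_density k" and \<alpha>: "1 / 2 \<le> \<alpha>" and p: "0 \<le> pstar" and K: "9 \<le> K"
    and d1: "0 < d1" and \<beta>: "0 < \<beta>"
    and noise: "\<And>t. norm (char_fun k t) \<le> d1 / (1 + \<bar>t\<bar> powr \<beta>) \<and> char_fun k differentiable (at t) \<and>
      norm (vector_derivative (char_fun k) (at t)) \<le> d1 / (1 + \<bar>t\<bar> powr \<beta>)"
  shows "\<exists>c>0. \<forall>n::nat. 1 \<le> n \<longrightarrow>
    ennreal (c * real n powr (- (2 * \<alpha>) / (2 * \<alpha> + 2 * \<beta> + 1))) \<le> minimax_risk k \<alpha> K pstar n"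
proof -
  define C where "C = 6 / tail_constant k"
  have C: "0 < C" using tail_constant_pos[OF k] by (simp add: C_def)
  define r where "r = 2 * \<alpha> + 2 * \<beta> + 1"
  have r: "0 < r" using \<alpha> \<beta> by (simp add: r_def)
  obtain c where c: "0 < c" "c \<le> 1 / 4" "c\<^sup>2 * (8 * (1 + 5 powr (2 * \<alpha>))) \<le> 1" "c\<^sup>2 * (C * d1\<^sup>2) \<le> 1"
    using exists_small_amplitude[of "8 * (1 + 5 powr (2 * \<alpha>))" "C * d1\<^sup>2"] C by auto
  \<comment> \<open>The integer m is at most x + 1, hence at most 2x; rounding costs the factor
    2^(-2\<alpha>).\<close>
  define c' where "c' = c\<^sup>2 * 2 powr (- (2 * \<alpha>)) / (1024 * pi)"
  have "ennreal (c' * real n powr (- (2 * \<alpha>) / r)) \<le> minimax_risk k \<alpha> K pstar n" if n: "1 \<le> n" for n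
  proof -
    define x where "x = real n powr (1 / r)"
    have x: "1 \<le> x" using n r by (simp add: x_def ge_one_powr_ge_zero)
    obtain m :: nat where m: "1 \<le> m" "x \<le> real m" "real m \<le> x + 1"
      using exists_nat_ceiling[of x] x by auto
    have m0: "0 < real m" using m by simp
    define a where "a = c * real m powr (- \<alpha> - 1 / 2)"
    define J where "J = {m + 1..2 * m}"
    define \<epsilon> where "\<epsilon> = d1 * real m powr (- \<beta>)"
    have card: "card J = m" by (simp add: J_def)
    have a2: "a\<^sup>2 * real m = c\<^sup>2 * real m powr (- (2 * \<alpha>))"
    proof -
      have "a\<^sup>2 * real m = c\<^sup>2 * (real m powr (- \<alpha> - 1 / 2) * real m powr (- \<alpha> - 1 / 2) * real m powr 1)"
        using m0 by (simp add: a_def power2_eq_square)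
      also have "real m powr (- \<alpha> - 1 / 2) * real m powr (- \<alpha> - 1 / 2) * real m powr 1 = real m powr (- (2 * \<alpha>))"
        unfolding powr_add[symmetric] by simp
      finally show ?thesis .
    qed
    interpret bump_family J a
    proof
      show "finite J" "0 \<notin> J" by (auto simp: J_def)
      show "0 \<le> a" using c by (simp add: a_def)
      have "a * real (card J) = c * (real m powr (- \<alpha> - 1 / 2) * real m powr 1)"
        using m0 by (simp add: a_def card)
      also have "real m powr (- \<alpha> - 1 / 2) * real m powr 1 = real m powr (1 / 2 - \<alpha>)"
        unfolding powr_add[symmetric] by simp
      also have "c * \<dots> \<le> 1 / 4 * 1"
        using c \<alpha> m(1) powr_mono[of "1 / 2 - \<alpha>" 0 "real m"] by (intro mult_mono) auto
      finally show "a * real (card J) \<le> 1 / 4" by simp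
    qed
    have "ennreal (a\<^sup>2 * real (card J) / (1024 * pi)) \<le> minimax_risk k \<alpha> K pstar n"
    proof (rule minimax_risk_ge[OF k p _ K, where N = "2 * m" and \<epsilon> = \<epsilon>])
      have "8 * a\<^sup>2 * real (card J) * (1 + (2 * real (2 * m) + 1) powr (2 * \<alpha>))
        = 8 * (a\<^sup>2 * real m) * (1 + (2 * real (2 * m) + 1) powr (2 * \<alpha>))"
        by (simp add: card)
      also have "\<dots> = 8 * c\<^sup>2 * (real m powr (- (2 * \<alpha>)) * (1 + (2 * real (2 * m) + 1) powr (2 * \<alpha>)))"
        unfolding a2 by simp
      also have "\<dots> \<le> 8 * c\<^sup>2 * (1 + 5 powr (2 * \<alpha>))"
        using m(1) \<alpha> by (intro mult_left_mono weight_le) auto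
      also have "\<dots> \<le> 1" using c(3) by (simp add: algebra_simps)
      finally show "8 * a\<^sup>2 * real (card J) * (1 + (2 * real (2 * m) + 1) powr (2 * \<alpha>)) \<le> 1" .
    next
      fix j t assume "j \<in> J" "2 * real j - 2 \<le> \<bar>t\<bar>"
      then have "real m \<le> \<bar>t\<bar>" by (auto simp: J_def)
      then have "real m powr \<beta> \<le> 1 + \<bar>t\<bar> powr \<beta>" using \<beta> powr_mono2[of \<beta> "real m" "\<bar>t\<bar>"] by simp
      then have "d1 / (1 + \<bar>t\<bar> powr \<beta>) \<le> d1 / real m powr \<beta>"
        using d1 m0 by (intro divide_left_mono mult_pos_pos) (auto simp: add_pos_nonneg)
      also have "\<dots> = \<epsilon>" by (simp add: \<epsilon>_def powr_minus divide_inverse)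
      finally show "norm (char_fun k t) \<le> \<epsilon> \<and> char_fun k differentiable (at t) \<and>
          norm (vector_derivative (char_fun k) (at t)) \<le> \<epsilon>"
        using noise[of t] by auto
    next
      have "real n = x powr r" using n r by (simp add: x_def powr_powr)
      also have "\<dots> \<le> real m powr r" using m x r by (intro powr_mono2) auto
      finally have nm: "real n \<le> real m powr r" .
      have "a\<^sup>2 * \<epsilon>\<^sup>2 = c\<^sup>2 * d1\<^sup>2 * (real m powr (- \<alpha> - 1 / 2) * real m powr (- \<alpha> - 1 / 2)
           * (real m powr (- \<beta>) * real m powr (- \<beta>)))"
        by (simp add: a_def \<epsilon>_def power2_eq_square)
      \<comment> \<open>The total exponent -2\<alpha> - 1 - 2\<beta> is exactly -r, so m^r \<ge> n
        bounds the product by a constant.\<close>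
      also have "real m powr (- \<alpha> - 1 / 2) * real m powr (- \<alpha> - 1 / 2) * (real m powr (- \<beta>) * real m powr (- \<beta>))
          = real m powr (- r)"
        unfolding powr_add[symmetric] r_def by (rule arg_cong[where f="\<lambda>e. real m powr e"]) simp
      finally have "real n * (6 / tail_constant k * a\<^sup>2 * \<epsilon>\<^sup>2) = (c\<^sup>2 * (C * d1\<^sup>2)) * (real n * real m powr (- r))"
        unfolding C_def[symmetric] by (simp add: mult_ac)
      also have "\<dots> \<le> 1 * (real m powr r * real m powr (- r))"
        using c(4) nm C by (intro mult_mono mult_right_mono) auto
      also have "\<dots> = 1" using m0 by (simp flip: powr_add)
      finally show "real n * (6 / tail_constant k * a\<^sup>2 * \<epsilon>\<^sup>2) \<le> 1" .
    qed (use \<alpha> d1 in \<open>auto simp: J_def \<epsilon>_def\<close>)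
    moreover have "c' * real n powr (- (2 * \<alpha>) / r) \<le> a\<^sup>2 * real (card J) / (1024 * pi)"
    proof -
      have "c' * real n powr (- (2 * \<alpha>) / r) = c\<^sup>2 * (2 * x) powr (- (2 * \<alpha>)) / (1024 * pi)"
        using x by (simp add: c'_def x_def powr_mult powr_powr mult_ac)
      also have "\<dots> \<le> c\<^sup>2 * real m powr (- (2 * \<alpha>)) / (1024 * pi)"
        using m x \<alpha> powr_mono2'[of "- (2 * \<alpha>)" "real m" "2 * x"]
        by (intro divide_right_mono mult_left_mono) auto
      finally show ?thesis unfolding card a2 .
    qed
    ultimately show ?thesis by (meson ennreal_leI order_trans)
  qed
  moreover have "0 < c'" using c by (simp add: c'_def)
  ultimately show ?thesis unfolding r_def by blast
qed

lemma minimax_risk_exponential: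
  assumes k: "prob_density k" and \<alpha>: "1 / 2 \<le> \<alpha>" and p: "0 \<le> pstar" and K: "9 \<le> K"
    and d1: "0 < d1" and \<beta>: "0 < \<beta>" and \<gamma>: "0 < \<gamma>"
    and noise: "\<And>t. norm (char_fun k t) \<le> d1 * exp (- (\<bar>t\<bar> powr \<beta>) / \<gamma>) \<and> char_fun k differentiable (at t) \<and>
      norm (vector_derivative (char_fun k) (at t)) \<le> d1 * exp (- (\<bar>t\<bar> powr \<beta>) / \<gamma>)"
  shows "\<exists>c>0. \<forall>n::nat. 2 \<le> n \<longrightarrow>
    ennreal (c * ln (real n) powr (- (2 * \<alpha>) / \<beta>)) \<le> minimax_risk k \<alpha> K pstar n"
proof -
  define C where "C = 6 / tail_constant k"
  have C: "0 < C" using tail_constant_pos[OF k] by (simp add: C_def)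
  obtain c where c: "0 < c" "c \<le> 1 / 4" "c\<^sup>2 * (8 * (1 + 5 powr (2 * \<alpha>))) \<le> 1" "c\<^sup>2 * (C * d1\<^sup>2) \<le> 1"
    using exists_small_amplitude[of "8 * (1 + 5 powr (2 * \<alpha>))" "C * d1\<^sup>2"] C by auto
  \<comment> \<open>\<open>B\<close> serves to bound m by \<open>B\<close> times (ln n)^(1/\<beta>).
    The second summand absorbs the rounding error 1, using ln n \<ge> ln 2; this is where n \<ge> 2
    enters.\<close>
  define B where "B = \<gamma> powr (1 / \<beta>) + ln 2 powr (- (1 / \<beta>))"
  have B: "0 < B" using \<gamma> by (simp add: B_def add_pos_nonneg)
  define c' where "c' = c\<^sup>2 * B powr (- (2 * \<alpha>)) / (1024 * pi)"
  have "ennreal (c' * ln (real n) powr (- (2 * \<alpha>) / \<beta>)) \<le> minimax_risk k \<alpha> K pstar n" if n: "2 \<le> n" for n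
  proof -
    have ln2: "0 < ln (2::real)" "ln 2 \<le> ln (real n)" "0 < ln (real n)" using n by auto
    define x where "x = (\<gamma> * ln (real n)) powr (1 / \<beta>)"
    have x: "0 < x" using \<gamma> ln2 by (simp add: x_def)
    obtain m :: nat where m: "1 \<le> m" "x \<le> real m" "real m \<le> x + 1"
      using exists_nat_ceiling[OF x] by auto
    have m0: "0 < real m" using m by simp
    define a where "a = c * real m powr (- \<alpha>)"
    define J where "J = {m + 1}"
    define \<epsilon> where "\<epsilon> = d1 * exp (- (real m powr \<beta>) / \<gamma>)"
    have card: "card J = 1" by (simp add: J_def)
    have a2: "a\<^sup>2 = c\<^sup>2 * real m powr (- (2 * \<alpha>))"
    proof -
      have "a\<^sup>2 = c\<^sup>2 * (real m powr (- \<alpha>) * real m powr (- \<alpha>))"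
        by (simp add: a_def power2_eq_square)
      also have "real m powr (- \<alpha>) * real m powr (- \<alpha>) = real m powr (- (2 * \<alpha>))"
        unfolding powr_add[symmetric] by simp
      finally show ?thesis .
    qed
    have powr_le_1: "real m powr (- e) \<le> 1" if "0 \<le> e" for e
      using powr_mono[of "- e" 0 "real m"] that m(1) by simp
    interpret bump_family J a
    proof
      show "finite J" "0 \<notin> J" by (auto simp: J_def)
      show "0 \<le> a" using c by (simp add: a_def)
      have "a \<le> 1 / 4 * 1"
        unfolding a_def using c \<alpha> powr_le_1[of \<alpha>] by (intro mult_mono) auto
      then show "a * real (card J) \<le> 1 / 4" by (simp add: card)
    qed
    have "ennreal (a\<^sup>2 * real (card J) / (1024 * pi)) \<le> minimax_risk k \<alpha> K pstar n"
    proof (rule minimax_risk_ge[OF k p _ K, where N = "m + 1" and \<epsilon> = \<epsilon>])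
      have "8 * a\<^sup>2 * real (card J) * (1 + (2 * real (m + 1) + 1) powr (2 * \<alpha>))
        = 8 * c\<^sup>2 * (real m powr (- (2 * \<alpha>)) * (1 + (2 * real (m + 1) + 1) powr (2 * \<alpha>)))"
        unfolding a2 card by simp
      also have "\<dots> \<le> 8 * c\<^sup>2 * (1 + 5 powr (2 * \<alpha>))"
        using m(1) \<alpha> by (intro mult_left_mono weight_le) auto
      also have "\<dots> \<le> 1" using c(3) by (simp add: algebra_simps)
      finally show "8 * a\<^sup>2 * real (card J) * (1 + (2 * real (m + 1) + 1) powr (2 * \<alpha>)) \<le> 1" .
    next
      fix j t assume "j \<in> J" "2 * real j - 2 \<le> \<bar>t\<bar>"
      then have "real m \<le> \<bar>t\<bar>" by (auto simp: J_def)
      then have "real m powr \<beta> \<le> \<bar>t\<bar> powr \<beta>" using \<beta> powr_mono2[of \<beta> "real m" "\<bar>t\<bar>"] by simp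
      then have "d1 * exp (- (\<bar>t\<bar> powr \<beta>) / \<gamma>) \<le> \<epsilon>"
        unfolding \<epsilon>_def using d1 \<gamma> by (intro mult_left_mono) (auto simp: divide_right_mono)
      then show "norm (char_fun k t) \<le> \<epsilon> \<and> char_fun k differentiable (at t) \<and>
          norm (vector_derivative (char_fun k) (at t)) \<le> \<epsilon>"
        using noise[of t] by auto
    next
      \<comment> \<open>With m^\<beta> at least \<gamma> ln n the noise level is at most d1 / n, so
        n \<epsilon>^2 stays bounded without any help from the amplitude's decay.\<close>
      have "\<gamma> * ln (real n) = x powr \<beta>" using \<beta> \<gamma> ln2 by (simp add: x_def powr_powr)
      also have "\<dots> \<le> real m powr \<beta>" using m x \<beta> by (intro powr_mono2) auto
      finally have "- (real m powr \<beta>) / \<gamma> \<le> - ln (real n)" using \<gamma> by (simp add: field_simps)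
      then have "exp (- (real m powr \<beta>) / \<gamma>) \<le> exp (- ln (real n))" by simp
      also have "\<dots> = 1 / real n" using n by (simp add: exp_minus inverse_eq_divide)
      finally have "\<epsilon> \<le> d1 * (1 / real n)" unfolding \<epsilon>_def using d1 by (intro mult_left_mono) auto
      then have "\<epsilon>\<^sup>2 \<le> (d1 * (1 / real n))\<^sup>2" using d1 by (intro power_mono) (auto simp: \<epsilon>_def)
      also have "\<dots> = d1\<^sup>2 * (1 / real n)\<^sup>2" by (rule power_mult_distrib)
      finally have e2: "\<epsilon>\<^sup>2 \<le> d1\<^sup>2 * (1 / real n)\<^sup>2" .
      have "a\<^sup>2 \<le> c\<^sup>2" unfolding a2 using powr_le_1[of "2 * \<alpha>"] \<alpha> by (simp add: mult_left_le)
      then have "real n * (6 / tail_constant k * a\<^sup>2 * \<epsilon>\<^sup>2) \<le> real n * (C * c\<^sup>2 * (d1\<^sup>2 * (1 / real n)\<^sup>2))"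
        unfolding C_def[symmetric] using C e2 by (intro mult_left_mono mult_mono) auto
      also have "\<dots> = (c\<^sup>2 * (C * d1\<^sup>2)) * (1 / real n)" using n by (simp add: power2_eq_square)
      also have "\<dots> \<le> 1 * 1" using c(4) n by (intro mult_mono) auto
      finally show "real n * (6 / tail_constant k * a\<^sup>2 * \<epsilon>\<^sup>2) \<le> 1" by simp
    qed (use \<alpha> d1 in \<open>auto simp: J_def \<epsilon>_def\<close>)
    moreover have "c' * ln (real n) powr (- (2 * \<alpha>) / \<beta>) \<le> a\<^sup>2 * real (card J) / (1024 * pi)"
    proof -
      define y where "y = ln (real n) powr (1 / \<beta>)"
      have y: "0 < y" using ln2 by (simp add: y_def)
      have "ln 2 powr (1 / \<beta>) \<le> y" unfolding y_def using ln2 \<beta> by (intro powr_mono2) auto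
      then have "ln 2 powr (- (1 / \<beta>)) * ln 2 powr (1 / \<beta>) \<le> ln 2 powr (- (1 / \<beta>)) * y"
        by (intro mult_left_mono) auto
      then have "1 \<le> ln 2 powr (- (1 / \<beta>)) * y" by (simp flip: powr_add)
      moreover have "x = \<gamma> powr (1 / \<beta>) * y" using \<gamma> ln2 by (simp add: x_def y_def powr_mult)
      ultimately have "real m \<le> B * y" using m(3) by (simp add: B_def distrib_right)
      have "c' * ln (real n) powr (- (2 * \<alpha>) / \<beta>) = c\<^sup>2 * (B * y) powr (- (2 * \<alpha>)) / (1024 * pi)"
        using B y by (simp add: c'_def y_def powr_mult powr_powr mult_ac)
      also have "\<dots> \<le> c\<^sup>2 * real m powr (- (2 * \<alpha>)) / (1024 * pi)"
        using \<open>real m \<le> B * y\<close> m0 \<alpha> powr_mono2'[of "- (2 * \<alpha>)" "real m" "B * y"]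
        by (intro divide_right_mono mult_left_mono) auto
      finally show ?thesis by (simp only: card a2 of_nat_1 mult_1_right)
    qed
    ultimately show ?thesis by (meson ennreal_leI order_trans)
  qed
  moreover have "0 < c'" using c B by (simp add: c'_def)
  ultimately show ?thesis by blast
qed

theorem theorem3:
  fixes k :: "real \<Rightarrow> real" and \<alpha> pstar :: real
  assumes "prob_density k"
    and "1 / 2 \<le> \<alpha>" and "0 \<le> pstar" and "pstar < 1"
  shows "\<exists>K0::real. \<forall>K\<ge>K0.
    (\<forall>d1 \<beta>::real. 0 < d1 \<longrightarrow> 0 < \<beta> \<longrightarrow>
       (\<forall>t. norm (char_fun k t) \<le> d1 / (1 + \<bar>t\<bar> powr \<beta>) \<and>
            char_fun k differentiable (at t) \<and>
            norm (vector_derivative (char_fun k) (at t)) \<le> d1 / (1 + \<bar>t\<bar> powr \<beta>)) \<longrightarrow>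
       (\<exists>c>0. \<forall>n::nat. 1 \<le> n \<longrightarrow>
          ennreal (c * real n powr (- (2 * \<alpha>) / (2 * \<alpha> + 2 * \<beta> + 1)))
            \<le> minimax_risk k \<alpha> K pstar n)) \<and>
    (\<forall>d1 \<beta> \<gamma>::real. 0 < d1 \<longrightarrow> 0 < \<beta> \<longrightarrow> 0 < \<gamma> \<longrightarrow>
       (\<forall>t. norm (char_fun k t) \<le> d1 * exp (- (\<bar>t\<bar> powr \<beta>) / \<gamma>) \<and>
            char_fun k differentiable (at t) \<and>
            norm (vector_derivative (char_fun k) (at t)) \<le> d1 * exp (- (\<bar>t\<bar> powr \<beta>) / \<gamma>)) \<longrightarrow>
       (\<exists>c>0. \<forall>n::nat. 2 \<le> n \<longrightarrow>
          ennreal (c * ln (real n) powr (- (2 * \<alpha>) / \<beta>))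
            \<le> minimax_risk k \<alpha> K pstar n))"
proof (rule exI[of _ 9], intro allI impI conjI)
  \<comment> \<open>The threshold 9 is the one required by
    \<open>perturbed_in_density_class\<close>; it depends neither on the noise nor on
    \<alpha>.\<close>
  fix K d1 \<beta> :: real
  assume "9 \<le> K" "0 < d1" "0 < \<beta>"
    "\<forall>t. norm (char_fun k t) \<le> d1 / (1 + \<bar>t\<bar> powr \<beta>) \<and> char_fun k differentiable (at t) \<and>
      norm (vector_derivative (char_fun k) (at t)) \<le> d1 / (1 + \<bar>t\<bar> powr \<beta>)"
  then show "\<exists>c>0. \<forall>n::nat. 1 \<le> n \<longrightarrow>
      ennreal (c * real n powr (- (2 * \<alpha>) / (2 * \<alpha> + 2 * \<beta> + 1))) \<le> minimax_risk k \<alpha> K pstar n"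
    using assms by (intro minimax_risk_polynomial[where ?d1.0=d1]) auto
next
  fix K d1 \<beta> \<gamma> :: real
  assume "9 \<le> K" "0 < d1" "0 < \<beta>" "0 < \<gamma>"
    "\<forall>t. norm (char_fun k t) \<le> d1 * exp (- (\<bar>t\<bar> powr \<beta>) / \<gamma>) \<and> char_fun k differentiable (at t) \<and>
      norm (vector_derivative (char_fun k) (at t)) \<le> d1 * exp (- (\<bar>t\<bar> powr \<beta>) / \<gamma>)"
  then show "\<exists>c>0. \<forall>n::nat. 2 \<le> n \<longrightarrow>
      ennreal (c * ln (real n) powr (- (2 * \<alpha>) / \<beta>)) \<le> minimax_risk k \<alpha> K pstar n"
    using assms by (intro minimax_risk_exponential[where ?d1.0=d1 and \<gamma>=\<gamma>]) auto
qed

end
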